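(* Let $G$ be an aperiodic, irreducible finite directed graph, let $X^G$ be its associated shift of finite type and let $\mu$ be the Parry measure on $X^G$. Then the Connes metric from $(C_\infty(X^G),L^2(X^G,\mu),D_{X^G})$ is infinite.
   Context: Graphs and shifts of finite type. $G=(G^0,G^1,i,t)$ is a finite directed graph: $G^0=\{1,\dots,I\}$ is the vertex set, $G^1$ the finite edge set, and $i,t:G^1\to G^0$ the initial and terminal vertex maps. $X^G=\{(x_n)_{n\in\mathbb{Z}}: x_n\in G^1,\ t(x_n)=i(x_{n+1})\text{ for all }n\in\mathbb{Z}\}\subseteq (G^1)^{\mathbb{Z}}$, with the left shift $\sigma(x)_n=x_{n+1}$. The incidence matrix is $A_{i,j}=\#\{e\in G^1:i(e)=i,t(e)=j\}$. $G$ is irreducible if for each $i,j$ there is $n\geq 1$ with $(A^n)_{i,j}>0$; $G$ is aperiodic if $X^G$ is infinite. Let $\lambda$ be the Perron eigenvalue of $A$, and $u,v$ the positive left and right eigenvectors of $A$ for $\lambda$, normalised by $\sum_kv_k=1$, $\sum_ku_kv_k=1$. The Parry measure $\mu$ is the unique $\sigma$-invariant probability measure of maximal entropy on $X^G$; the cylinder set of an admissible word of edges $(w_1,\dots,w_n)$ has measure $u_{i(w_1)}v_{t(w_n)}\lambda^{-n}$. Spectral triple. Let $X=X^G$. For $n\ge1$, $X_n=\{(x_1,\dots,x_n):x\in X\}$. For $w\in X_n$, $U(w)=\{x\in X:(x_{-m},\dots,x_m)=w\}$ if $n=2m+1$, and $U(w)=\{x\in X:(x_{1-m},\dots,x_m)=w\}$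 if $n=2m\ge2$; $\xi(w)$ is the characteristic function of $U(w)$. Set $C_{-1}=\{0\}$, $C_0=\mathbb{C}1$, $C_n=\mathrm{span}\{\xi(w):w\in X_n\}$ for $n\ge1$, viewed both in $C(X)$ and in $L^2(X,\mu)$; $C_\infty(X)=\bigcup_nC_n$, acting on $L^2(X,\mu)$ by multiplication. $D_X$ is the operator on $L^2(X,\mu)$ with domain $\{\sum_{n\ge0}\xi_n:\xi_n\in C_n\cap C_{n-1}^\perp,\ \sum_n(n\|\xi_n\|)^2<\infty\}$ and $D_X\xi=n\xi$ for $\xi\in C_n\cap C_{n-1}^\perp$, $n\ge0$. For every $f\in C_\infty(X)$, $[D_X,f]$ extends to a bounded operator, whose norm is denoted $\|[D_X,f]\|$. Connes metric. On the state space of $C(X)$, $d(\phi,\psi)=\sup\{|\phi(f)-\psi(f)|: f\in C_\infty(X),\ \|[D_X,f]\|\le1\}\in[0,\infty]$. The Connes metric is called finite if $d(\phi,\psi)<\infty$ for all states $\phi,\psi$, and infinite otherwise (by the uniform boundedness principle, it is infinite if and only if the image of $\{f\in C_\infty(X):\|[D_X,f]\|\le1\}$ in $C(X)/\mathbb{C}1$ is unbounded for the quotient of the supremum norm). *)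

theory Defs
  imports
    "HOL-Probability.Probability"
    "Graph_Theory.Digraph"
    "Jordan_Normal_Form.Spectral_Radius"
begin

(* Both vector libraries use the same symbol; below it always means the index function
   of Jordan_Normal_Form vectors. *)
no_notation Finite_Cartesian_Product.vec_nth (infixl \<open>$\<close> 90)

section \<open>Graphs and their shifts of finite type\<close>

text \<open>A finite directed graph is a \<open>fin_digraph\<close> (loops and parallel edges are allowed) with
  \<open>tail\<close> and \<open>head\<close> as initial and terminal vertex maps. Since rows and columns of matrices are
  numbered from 0, its vertex set is \<open>{0..<I}\<close> with \<open>I = card (verts G)\<close>.\<close>

definition incidence_mat :: "(nat, 'e) pre_digraph \<Rightarrow> 'r::semiring_1 mat" where
  "incidence_mat G = mat (card (verts G)) (card (verts G))
     (\<lambda>(j, k). of_nat (card {e \<in> arcs G. tail G e = j \<and> head G e = k}))"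

definition irreducible_graph :: "(nat, 'e) pre_digraph \<Rightarrow> bool" where
  "irreducible_graph G \<longleftrightarrow>
     (\<forall>j\<in>verts G. \<forall>k\<in>verts G. \<exists>n\<ge>1. ((incidence_mat G :: nat mat) ^\<^sub>m n) $$ (j, k) > 0)"

definition sft :: "(nat, 'e) pre_digraph \<Rightarrow> (int \<Rightarrow> 'e) set" where
  "sft G = {x. \<forall>n. x n \<in> arcs G \<and> head G (x n) = tail G (x (n + 1))}"

definition shift :: "(int \<Rightarrow> 'e) \<Rightarrow> int \<Rightarrow> 'e" where
  "shift x = (\<lambda>n. x (n + 1))"

definition aperiodic_graph :: "(nat, 'e) pre_digraph \<Rightarrow> bool" where
  "aperiodic_graph G \<longleftrightarrow> infinite (sft G)"

definition sft_topology :: "(nat, 'e) pre_digraph \<Rightarrow> (int \<Rightarrow> 'e) topology" where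
  "sft_topology G =
     subtopology (product_topology (\<lambda>_. discrete_topology (arcs G)) UNIV) (sft G)"

definition sft_borel :: "(nat, 'e) pre_digraph \<Rightarrow> (int \<Rightarrow> 'e) measure" where
  "sft_borel G = sigma (sft G) {V. openin (sft_topology G) V}"

definition words :: "(nat, 'e) pre_digraph \<Rightarrow> nat \<Rightarrow> 'e list set" where
  "words G n = (\<lambda>x. map x [1..int n]) ` sft G"

section \<open>The Parry measure\<close>

definition perron_data ::
    "(nat, 'e) pre_digraph \<Rightarrow> real \<Rightarrow> real Matrix.vec \<Rightarrow> real Matrix.vec \<Rightarrow> bool" where
  "perron_data G lam u v \<longleftrightarrow>
     lam = spectral_radius (incidence_mat G) \<and>
     eigenvector (transpose_mat (incidence_mat G)) u lam \<and>
     eigenvector (incidence_mat G) v lam \<and>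
     (\<forall>k\<in>verts G. u $ k > 0 \<and> v $ k > 0) \<and>
     (\<Sum>k\<in>verts G. v $ k) = 1 \<and>
     (\<Sum>k\<in>verts G. u $ k * v $ k) = 1"

definition invariant_prob :: "(nat, 'e) pre_digraph \<Rightarrow> (int \<Rightarrow> 'e) measure \<Rightarrow> bool" where
  "invariant_prob G M \<longleftrightarrow> prob_space M \<and> sets M = sets (sft_borel G) \<and>
     (\<forall>A\<in>sets M. emeasure M (shift -` A \<inter> space M) = emeasure M A)"

text \<open>Kolmogorov--Sinai entropy of the shift. The functions \<open>s\<close> enumerate the atoms of the join
  of the preimages of \<open>P\<close> under \<open>shift ^^ k\<close>, \<open>k < n\<close>; an empty or null atom contributes 0.
  The limit exists for every invariant probability measure, by subadditivity.\<close>

definition join_entropy :: "(int \<Rightarrow> 'e) measure \<Rightarrow> (int \<Rightarrow> 'e) set set \<Rightarrow> nat \<Rightarrow> real" where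
  "join_entropy M P n = - (\<Sum>s \<in> {..<n} \<rightarrow>\<^sub>E P.
     let p = measure M {x \<in> space M. \<forall>k<n. (shift ^^ k) x \<in> s k} in p * ln p)"

definition ks_entropy :: "(int \<Rightarrow> 'e) measure \<Rightarrow> ereal" where
  "ks_entropy M =
     (SUP P \<in> {P. finite P \<and> P \<subseteq> sets M \<and> partition_on (space M) P}.
        ereal (lim (\<lambda>n. join_entropy M P n / real n)))"

text \<open>The Parry measure as the measure of maximal entropy, together with its explicit values on
  cylinder sets. By Parry's theorem each of the two descriptions alone determines the same unique
  measure, so their conjunction is no restriction.\<close>

definition parry_measure :: "(nat, 'e) pre_digraph \<Rightarrow> (int \<Rightarrow> 'e) measure \<Rightarrow> bool" where
  "parry_measure G M \<longleftrightarrow>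
     invariant_prob G M \<and>
     (\<forall>N. invariant_prob G N \<longrightarrow> ks_entropy N \<le> ks_entropy M) \<and>
     (\<exists>lam u v. perron_data G lam u v \<and>
        (\<forall>n\<ge>1. \<forall>w\<in>words G n.
           measure M {x \<in> sft G. map x [1..int n] = w} =
             u $ tail G (hd w) * v $ head G (last w) / lam ^ n))"

section \<open>The Hilbert space\<close>

text \<open>Elements of \<open>L\<^sup>2\<close> are represented by square integrable functions; two of them are the same
  vector if they agree almost everywhere. All notions below respect this.\<close>

definition l2 :: "'x measure \<Rightarrow> ('x \<Rightarrow> complex) set" where
  "l2 M = {f \<in> borel_measurable M. integrable M (\<lambda>x. (cmod (f x))\<^sup>2)}"

definition l2_inner :: "'x measure \<Rightarrow> ('x \<Rightarrow> complex) \<Rightarrow> ('x \<Rightarrow> complex) \<Rightarrow> complex" where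
  "l2_inner M f g = (LINT x|M. f x * cnj (g x))"

definition l2_norm :: "'x measure \<Rightarrow> ('x \<Rightarrow> complex) \<Rightarrow> real" where
  "l2_norm M f = sqrt (LINT x|M. (cmod (f x))\<^sup>2)"

definition l2_sums :: "'x measure \<Rightarrow> (nat \<Rightarrow> 'x \<Rightarrow> complex) \<Rightarrow> ('x \<Rightarrow> complex) \<Rightarrow> bool" where
  "l2_sums M c f \<longleftrightarrow> (\<lambda>N. l2_norm M (\<lambda>x. f x - (\<Sum>n<N. c n x))) \<longlonglongrightarrow> 0"

section \<open>The spectral triple\<close>

text \<open>Functions on \<open>sft G\<close> are total functions vanishing outside \<open>sft G\<close>; in particular the
  constant function 1 is \<open>indicator (sft G)\<close>.\<close>

definition window :: "nat \<Rightarrow> int list" where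
  "window n = (let m = int (n div 2) in if odd n then [- m..m] else [1 - m..m])"

definition cyl :: "(nat, 'e) pre_digraph \<Rightarrow> 'e list \<Rightarrow> (int \<Rightarrow> 'e) set" where
  "cyl G w = {x \<in> sft G. map x (window (length w)) = w}"

definition level :: "(nat, 'e) pre_digraph \<Rightarrow> int \<Rightarrow> ((int \<Rightarrow> 'e) \<Rightarrow> complex) set" where
  "level G k =
     (if k < 0 then {\<lambda>_. 0}
      else if k = 0 then {\<lambda>x. c * indicator (sft G) x |c. True}
      else {\<lambda>x. \<Sum>w\<in>words G (nat k). c w * indicator (cyl G w) x |c. True})"

definition c_infty :: "(nat, 'e) pre_digraph \<Rightarrow> ((int \<Rightarrow> 'e) \<Rightarrow> complex) set" where
  "c_infty G = (\<Union>k. level G k)"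

definition level_perp ::
    "(nat, 'e) pre_digraph \<Rightarrow> (int \<Rightarrow> 'e) measure \<Rightarrow> nat \<Rightarrow> ((int \<Rightarrow> 'e) \<Rightarrow> complex) set" where
  "level_perp G M n =
     {f \<in> level G (int n). \<forall>g\<in>level G (int n - 1). l2_inner M f g = 0}"

text \<open>The graph of the unbounded operator \<open>D\<close>: \<open>dirac G M f g\<close> says that \<open>f\<close> is in the domain
  and \<open>D f = g\<close> (almost everywhere).\<close>

definition dirac ::
    "(nat, 'e) pre_digraph \<Rightarrow> (int \<Rightarrow> 'e) measure \<Rightarrow>
     ((int \<Rightarrow> 'e) \<Rightarrow> complex) \<Rightarrow> ((int \<Rightarrow> 'e) \<Rightarrow> complex) \<Rightarrow> bool" where
  "dirac G M f g \<longleftrightarrow> f \<in> l2 M \<and> g \<in> l2 M \<and>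
     (\<exists>c. (\<forall>n. c n \<in> level_perp G M n) \<and>
          summable (\<lambda>n. (real n * l2_norm M (c n))\<^sup>2) \<and>
          l2_sums M c f \<and>
          l2_sums M (\<lambda>n x. of_nat n * c n x) g)"

text \<open>The norm of the commutator of \<open>D\<close> with multiplication by \<open>f\<close>. For \<open>f\<close> in \<open>c_infty G\<close>
  multiplication by \<open>f\<close> maps the (dense) domain of \<open>D\<close> into itself, so the norm of the bounded
  extension is the supremum over the unit ball of that domain; here \<open>g = D h\<close> and
  \<open>k = D (f h)\<close>.\<close>

definition commutator_norm ::
    "(nat, 'e) pre_digraph \<Rightarrow> (int \<Rightarrow> 'e) measure \<Rightarrow> ((int \<Rightarrow> 'e) \<Rightarrow> complex) \<Rightarrow> ennreal" where
  "commutator_norm G M f =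
     (SUP (h, g, k) \<in> {(h, g, k). dirac G M h g \<and> dirac G M (\<lambda>x. f x * h x) k \<and>
                                 l2_norm M h \<le> 1}.
        ennreal (l2_norm M (\<lambda>x. k x - f x * g x)))"

section \<open>The Connes metric\<close>

definition continuous_functions :: "(nat, 'e) pre_digraph \<Rightarrow> ((int \<Rightarrow> 'e) \<Rightarrow> complex) set" where
  "continuous_functions G =
     {f. continuous_map (sft_topology G) euclidean f \<and> (\<forall>x. x \<notin> sft G \<longrightarrow> f x = 0)}"

definition is_state :: "(nat, 'e) pre_digraph \<Rightarrow> (((int \<Rightarrow> 'e) \<Rightarrow> complex) \<Rightarrow> complex) \<Rightarrow> bool" where
  "is_state G \<phi> \<longleftrightarrow>
     (\<forall>f\<in>continuous_functions G. \<forall>g\<in>continuous_functions G.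
        \<phi> (\<lambda>x. f x + g x) = \<phi> f + \<phi> g) \<and>
     (\<forall>a. \<forall>f\<in>continuous_functions G. \<phi> (\<lambda>x. a * f x) = a * \<phi> f) \<and>
     (\<forall>f\<in>continuous_functions G.
        (\<forall>x\<in>sft G. f x \<in> \<real>\<^sub>\<ge>\<^sub>0) \<longrightarrow> \<phi> f \<in> \<real>\<^sub>\<ge>\<^sub>0) \<and>
     \<phi> (indicator (sft G)) = 1"

definition connes_metric ::
    "(nat, 'e) pre_digraph \<Rightarrow> (int \<Rightarrow> 'e) measure \<Rightarrow>
     (((int \<Rightarrow> 'e) \<Rightarrow> complex) \<Rightarrow> complex) \<Rightarrow> (((int \<Rightarrow> 'e) \<Rightarrow> complex) \<Rightarrow> complex) \<Rightarrow> ennreal" where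
  "connes_metric G M \<phi> \<psi> =
     (SUP f \<in> {f \<in> c_infty G. commutator_norm G M f \<le> 1}. ennreal (cmod (\<phi> f - \<psi> f)))"

definition connes_finite :: "(nat, 'e) pre_digraph \<Rightarrow> (int \<Rightarrow> 'e) measure \<Rightarrow> bool" where
  "connes_finite G M \<longleftrightarrow>
     (\<forall>\<phi> \<psi>. is_state G \<phi> \<longrightarrow> is_state G \<psi> \<longrightarrow> connes_metric G M \<phi> \<psi> < \<infinity>)"

abbreviation connes_infinite :: "(nat, 'e) pre_digraph \<Rightarrow> (int \<Rightarrow> 'e) measure \<Rightarrow> bool" where
  "connes_infinite G M \<equiv> \<not> connes_finite G M"

end

theory Submission
  imports Defs
begin

text \<open>The supremum defining the metric is already infinite between two point evaluations, and the
  functions that show it are explicit. Fix a point \<open>z\<close> of the shift space, let \<open>U\<^sub>k\<close> be the cylinder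
  of level \<open>k\<close> around \<open>z\<close>, and let \<open>f\<^sub>K\<close> be the sum of the indicator functions of
  \<open>U\<^sub>1, \<dots>, U\<^sub>K\<close> (the function \<open>tower\<close>). At \<open>z\<close> it has the value \<open>K\<close>; at any other point
  \<open>y\<close> it is bounded independently of \<open>K\<close>, because \<open>y\<close> leaves the cylinders from some level on. It
  remains to bound the commutators \<open>[D, f\<^sub>K]\<close> uniformly in \<open>K\<close> (\<open>commutator_norm_tower\<close>).

  Let \<open>E\<^sub>j\<close> be the projection onto the functions of level \<open>j\<close>, which averages over cylinders of level
  \<open>j\<close>. Then \<open>D = \<Sum>\<^sub>j (1 - E\<^sub>j)\<close> (\<open>dirac_inner\<close>), so \<open>[D, f\<^sub>K]\<close> is, up to sign, the sum of the
  commutators of \<open>E\<^sub>j\<close> with the indicator functions of the \<open>U\<^sub>k\<close>. These vanish for \<open>k \<le> j\<close>. For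
  \<open>j < k\<close> the only cylinder of level \<open>j\<close> that meets \<open>U\<^sub>k\<close> is \<open>U\<^sub>j\<close>, and the commutator is the rank
  two operator with matrix coefficients
  \<open>(\<langle>h, 1\<^bsub>U\<^sub>j\<^esub>\<rangle> \<langle>1\<^bsub>U\<^sub>k\<^esub>, \<phi>\<rangle> - \<langle>h, 1\<^bsub>U\<^sub>k\<^esub>\<rangle> \<langle>1\<^bsub>U\<^sub>j\<^esub>, \<phi>\<rangle>) / \<mu>(U\<^sub>j)\<close>
  (\<open>average_nbhd_commutator\<close>).

  The triangle inequality alone does not bound the sum over \<open>j < k\<close> uniformly in \<open>K\<close>, since the
  contributions of the single \<open>j\<close> are of comparable size. What helps is orthogonality. For the Parry measure,
  \<open>\<mu>(U\<^sub>k)\<close> is comparable to \<open>\<lambda>\<^sup>-\<^sup>k\<close>, and \<open>\<lambda> > 1\<close> because an infinite shift space has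
  arbitrarily many disjoint cylinders of equal level (\<open>cylinder_rate_gt_1\<close>). Hence the normalised indicator
  functions of \<open>U\<^sub>j\<close> and \<open>U\<^sub>k\<close> have an inner product of order \<open>\<lambda>\<^bsup>-|j - k|/2\<^esup>\<close>. By Schur's
  test (\<open>power_distance_form_le\<close>) they satisfy a Bessel inequality (\<open>bessel_tower\<close>), and the same
  test bounds the double sum of the matrix coefficients (\<open>l2_inner_tower_commutator_le\<close>).\<close>

section \<open>Square integrable functions\<close>

lemma l2_mult_integrable:
  assumes "f \<in> l2 M" "g \<in> l2 M"
  shows "integrable M (\<lambda>x. cmod (f x) * cmod (g x))"
    and "integrable M (\<lambda>x. f x * cnj (g x))"
proof -
  have [measurable]: "f \<in> borel_measurable M" "g \<in> borel_measurable M"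
    using assms by (auto simp: l2_def)
  have [measurable]: "cnj \<in> borel_measurable borel"
    by (intro borel_measurable_continuous_onI continuous_intros)
  have int: "integrable M (\<lambda>x. (cmod (f x))\<^sup>2 + (cmod (g x))\<^sup>2)"
    using assms by (auto simp: l2_def)
  have le: "cmod (f x) * cmod (g x) \<le> (cmod (f x))\<^sup>2 + (cmod (g x))\<^sup>2" for x
    using sum_squares_bound[of "cmod (f x)" "cmod (g x)"]
      mult_nonneg_nonneg[OF norm_ge_zero[of "f x"] norm_ge_zero[of "g x"]]
    by (simp only: mult.assoc)
  show "integrable M (\<lambda>x. cmod (f x) * cmod (g x))"
    by (rule Bochner_Integration.integrable_bound[OF int]) (use le in \<open>auto intro!: AE_I2\<close>)
  show "integrable M (\<lambda>x. f x * cnj (g x))"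
    by (rule Bochner_Integration.integrable_bound[OF int])
      (use le in \<open>auto intro!: AE_I2 simp: norm_mult\<close>)
qed

lemma l2_norm_nonneg [simp]: "0 \<le> l2_norm M f"
  by (simp add: l2_norm_def)

lemma l2_norm_square: "(l2_norm M f)\<^sup>2 = (LINT x|M. (cmod (f x))\<^sup>2)"
  by (simp add: l2_norm_def)

lemma l2_cauchy_schwarz_cmod:
  assumes f: "f \<in> l2 M" and g: "g \<in> l2 M"
  shows "(LINT x|M. cmod (f x) * cmod (g x)) \<le> l2_norm M f * l2_norm M g"
proof -
  define c where "c = (LINT x|M. cmod (f x) * cmod (g x))"
  define A where "A = (l2_norm M f)\<^sup>2"
  define B where "B = (l2_norm M g)\<^sup>2"
  have c0: "0 \<le> c" unfolding c_def by (intro integral_nonneg_AE AE_I2) auto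
  \<comment> \<open>The quadratic polynomial \<open>\<parallel>|f| - t |g|\<parallel>\<^sup>2\<close> in \<open>t\<close> is nonnegative.\<close>
  have quad: "0 \<le> A - 2 * t * c + t\<^sup>2 * B" for t
  proof -
    have "0 \<le> (LINT x|M. (cmod (f x) - t * cmod (g x))\<^sup>2)" by (intro integral_nonneg_AE AE_I2) auto
    also have "\<dots> = (LINT x|M. (cmod (f x))\<^sup>2 - 2 * t * (cmod (f x) * cmod (g x)) + t\<^sup>2 * (cmod (g x))\<^sup>2)"
      by (intro Bochner_Integration.integral_cong refl) (simp add: power2_eq_square algebra_simps)
    also have "\<dots> = A - 2 * t * c + t\<^sup>2 * B"
      using f g l2_mult_integrable[OF f g]
      by (simp add: l2_def A_def B_def c_def l2_norm_square)
    finally show ?thesis .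
  qed
  have "c\<^sup>2 \<le> A * B"
  proof (cases "B = 0")
    case True
    have "c = 0"
    proof (rule ccontr)
      assume "c \<noteq> 0"
      with quad[of "(A + 1) / (2 * c)"] True show False by (simp add: field_simps)
    qed
    with True show ?thesis by simp
  next
    case False
    hence "B > 0" by (simp add: B_def)
    with quad[of "c / B"] show ?thesis by (simp add: field_simps power2_eq_square)
  qed
  hence "c\<^sup>2 \<le> (l2_norm M f * l2_norm M g)\<^sup>2" by (simp add: A_def B_def power_mult_distrib)
  thus ?thesis unfolding c_def[symmetric] by (rule power2_le_imp_le) simp
qed

lemma l2_cauchy_schwarz:
  assumes "f \<in> l2 M" "g \<in> l2 M"
  shows "cmod (l2_inner M f g) \<le> l2_norm M f * l2_norm M g"
proof -
  have "cmod (l2_inner M f g) \<le> (LINT x|M. cmod (f x * cnj (g x)))"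
    unfolding l2_inner_def by (rule integral_norm_bound)
  thus ?thesis using l2_cauchy_schwarz_cmod[OF assms] by (simp add: norm_mult)
qed

lemma l2_add:
  assumes "f \<in> l2 M" "g \<in> l2 M"
  shows "(\<lambda>x. f x + g x) \<in> l2 M"
proof -
  have [measurable]: "f \<in> borel_measurable M" "g \<in> borel_measurable M"
    using assms by (auto simp: l2_def)
  have int: "integrable M (\<lambda>x. 2 * (cmod (f x))\<^sup>2 + 2 * (cmod (g x))\<^sup>2)"
    using assms by (auto simp: l2_def)
  have le: "(cmod (f x + g x))\<^sup>2 \<le> 2 * (cmod (f x))\<^sup>2 + 2 * (cmod (g x))\<^sup>2" for x
  proof -
    have "(cmod (f x + g x))\<^sup>2 \<le> (cmod (f x) + cmod (g x))\<^sup>2"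
      by (intro power_mono norm_triangle_ineq) auto
    also have "\<dots> \<le> 2 * (cmod (f x))\<^sup>2 + 2 * (cmod (g x))\<^sup>2"
      using sum_squares_bound[of "cmod (f x)" "cmod (g x)"] by (simp add: power2_sum)
    finally show ?thesis .
  qed
  have "integrable M (\<lambda>x. (cmod (f x + g x))\<^sup>2)"
    by (rule Bochner_Integration.integrable_bound[OF int]) (use le in \<open>auto intro!: AE_I2\<close>)
  thus ?thesis by (simp add: l2_def)
qed

lemma l2_bounded_mult:
  assumes f: "f \<in> l2 M" and [measurable]: "b \<in> borel_measurable M" and B: "\<And>x. cmod (b x) \<le> B"
  shows "(\<lambda>x. b x * f x) \<in> l2 M" and "l2_norm M (\<lambda>x. b x * f x) \<le> B * l2_norm M f"
proof -
  have [measurable]: "f \<in> borel_measurable M" using f by (auto simp: l2_def)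
  have B0: "0 \<le> B" using B[of undefined] by (meson norm_ge_zero order_trans)
  have int: "integrable M (\<lambda>x. B\<^sup>2 * (cmod (f x))\<^sup>2)" using f by (auto simp: l2_def)
  have le: "(cmod (b x * f x))\<^sup>2 \<le> B\<^sup>2 * (cmod (f x))\<^sup>2" for x
    using B[of x] by (simp add: norm_mult power_mult_distrib mult_right_mono power_mono)
  have int2: "integrable M (\<lambda>x. (cmod (b x * f x))\<^sup>2)"
    by (rule Bochner_Integration.integrable_bound[OF int]) (use le in \<open>auto intro!: AE_I2\<close>)
  thus "(\<lambda>x. b x * f x) \<in> l2 M" by (simp add: l2_def)
  have "(LINT x|M. (cmod (b x * f x))\<^sup>2) \<le> (LINT x|M. B\<^sup>2 * (cmod (f x))\<^sup>2)"
    by (rule integral_mono[OF int2 int le])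
  hence "l2_norm M (\<lambda>x. b x * f x) \<le> sqrt (B\<^sup>2 * (LINT x|M. (cmod (f x))\<^sup>2))"
    by (simp add: l2_norm_def)
  thus "l2_norm M (\<lambda>x. b x * f x) \<le> B * l2_norm M f"
    using B0 by (simp add: l2_norm_def real_sqrt_mult)
qed

lemma l2_cmult: "f \<in> l2 M \<Longrightarrow> (\<lambda>x. c * f x) \<in> l2 M"
  using l2_bounded_mult(1)[of f M "\<lambda>_. c" "cmod c"] by simp

lemma l2_diff:
  assumes "f \<in> l2 M" "g \<in> l2 M"
  shows "(\<lambda>x. f x - g x) \<in> l2 M"
  using l2_add[OF assms(1) l2_cmult[OF assms(2), of "-1"]] by simp

lemma l2_zero [simp]: "(\<lambda>_. 0) \<in> l2 M"
  by (simp add: l2_def)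

lemma l2_sum:
  assumes "\<And>n. n \<in> N \<Longrightarrow> f n \<in> l2 M"
  shows "(\<lambda>x. \<Sum>n\<in>N. f n x) \<in> l2 M"
  using assms by (induction N rule: infinite_finite_induct) (auto intro: l2_add)

lemma l2_norm_triangle:
  assumes f: "f \<in> l2 M" and g: "g \<in> l2 M"
  shows "l2_norm M (\<lambda>x. f x + g x) \<le> l2_norm M f + l2_norm M g"
proof -
  have "(l2_norm M (\<lambda>x. f x + g x))\<^sup>2
      \<le> (LINT x|M. (cmod (f x))\<^sup>2 + 2 * (cmod (f x) * cmod (g x)) + (cmod (g x))\<^sup>2)"
    unfolding l2_norm_square
  proof (rule integral_mono)
    show "integrable M (\<lambda>x. (cmod (f x + g x))\<^sup>2)" using l2_add[OF f g] by (simp add: l2_def)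
    show "integrable M (\<lambda>x. (cmod (f x))\<^sup>2 + 2 * (cmod (f x) * cmod (g x)) + (cmod (g x))\<^sup>2)"
      using f g l2_mult_integrable[OF f g] by (simp add: l2_def)
    show "(cmod (f x + g x))\<^sup>2
        \<le> (cmod (f x))\<^sup>2 + 2 * (cmod (f x) * cmod (g x)) + (cmod (g x))\<^sup>2" for x
      using power_mono[OF norm_triangle_ineq[of "f x" "g x"], of 2]
      by (simp add: power2_sum algebra_simps)
  qed
  also have "\<dots> = (l2_norm M f)\<^sup>2 + 2 * (LINT x|M. cmod (f x) * cmod (g x)) + (l2_norm M g)\<^sup>2"
    using f g l2_mult_integrable[OF f g] by (simp add: l2_def l2_norm_square)
  also have "\<dots> \<le> (l2_norm M f + l2_norm M g)\<^sup>2"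
    using l2_cauchy_schwarz_cmod[OF f g] by (simp add: power2_sum)
  finally show ?thesis by (rule power2_le_imp_le) simp
qed

lemma l2_norm_minus_commute: "l2_norm M (\<lambda>x. f x - g x) = l2_norm M (\<lambda>x. g x - f x)"
  by (simp add: l2_norm_def norm_minus_commute)

lemma l2_inner_diff_left:
  assumes "f \<in> l2 M" "g \<in> l2 M" "h \<in> l2 M"
  shows "l2_inner M (\<lambda>x. f x - g x) h = l2_inner M f h - l2_inner M g h"
  by (simp add: l2_inner_def left_diff_distrib l2_mult_integrable(2) assms)

lemma l2_inner_diff_right:
  assumes "f \<in> l2 M" "g \<in> l2 M" "h \<in> l2 M"
  shows "l2_inner M h (\<lambda>x. f x - g x) = l2_inner M h f - l2_inner M h g"
  by (simp add: l2_inner_def right_diff_distrib l2_mult_integrable(2) assms)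

lemma l2_inner_cmult_left: "l2_inner M (\<lambda>x. c * f x) h = c * l2_inner M f h"
  by (simp add: l2_inner_def mult.assoc)

lemma l2_inner_sum_left:
  assumes "\<And>n. n \<in> N \<Longrightarrow> f n \<in> l2 M" "h \<in> l2 M"
  shows "l2_inner M (\<lambda>x. \<Sum>n\<in>N. f n x) h = (\<Sum>n\<in>N. l2_inner M (f n) h)"
  by (simp add: l2_inner_def sum_distrib_right l2_mult_integrable(2) assms)

lemma l2_inner_self: "l2_inner M f f = of_real ((l2_norm M f)\<^sup>2)"
  unfolding l2_inner_def l2_norm_square complex_norm_square[symmetric]
  by (simp only: integral_complex_of_real)

lemma l2_inner_tendsto:
  assumes F: "\<And>N. F N \<in> l2 M" and f: "f \<in> l2 M" and h: "h \<in> l2 M"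
    and lim: "(\<lambda>N. l2_norm M (\<lambda>x. f x - F N x)) \<longlonglongrightarrow> 0"
  shows "(\<lambda>N. l2_inner M (F N) h) \<longlonglongrightarrow> l2_inner M f h"
proof -
  have "(\<lambda>N. l2_norm M (\<lambda>x. f x - F N x) * l2_norm M h) \<longlonglongrightarrow> 0"
    using tendsto_mult_right[OF lim, of "l2_norm M h"] by simp
  hence "(\<lambda>N. l2_inner M f h - l2_inner M (F N) h) \<longlonglongrightarrow> 0"
  proof (rule Lim_null_comparison[rotated], intro always_eventually allI)
    fix N
    show "norm (l2_inner M f h - l2_inner M (F N) h) \<le> l2_norm M (\<lambda>x. f x - F N x) * l2_norm M h"
      using l2_cauchy_schwarz[OF l2_diff[OF f F] h] l2_inner_diff_left[OF f F h] by simp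
  qed
  from tendsto_diff[OF tendsto_const[of "l2_inner M f h"] this] show ?thesis by simp
qed

text \<open>A vector in the closure of a subspace has norm at most 1 if its inner products with the
  subspace are bounded by the norms. Here the bound \<open>\<parallel>F N\<parallel>\<close> is relaxed to
  \<open>(1 + \<parallel>F N\<parallel>\<^sup>2) / 2\<close>, in which form bilinear estimates by sums of squares give it; in the limit
  it still says \<open>\<parallel>z\<parallel>\<^sup>2 \<le> (1 + \<parallel>z\<parallel>\<^sup>2) / 2\<close>.\<close>

lemma l2_norm_le_1_by_testing:
  assumes F: "\<And>N. F N \<in> l2 M" and z: "z \<in> l2 M"
    and lim: "(\<lambda>N. l2_norm M (\<lambda>x. z x - F N x)) \<longlonglongrightarrow> 0"
    and test: "\<And>N. N \<ge> N0 \<Longrightarrow> cmod (l2_inner M z (F N)) \<le> (1 + (l2_norm M (F N))\<^sup>2) / 2"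
  shows "l2_norm M z \<le> 1"
proof -
  define e where "e N = l2_norm M (\<lambda>x. z x - F N x)" for N
  have le: "(l2_norm M z)\<^sup>2 \<le> l2_norm M z * e N + (1 + (l2_norm M z + e N)\<^sup>2) / 2"
    if N: "N \<ge> N0" for N
  proof -
    have "(l2_norm M z)\<^sup>2 = cmod (l2_inner M z z)"
      unfolding l2_inner_self norm_of_real by simp
    also have "l2_inner M z z = l2_inner M z (\<lambda>x. z x - F N x) + l2_inner M z (F N)"
      by (simp add: l2_inner_diff_right[OF z F z])
    also have "cmod \<dots> \<le> cmod (l2_inner M z (\<lambda>x. z x - F N x)) + cmod (l2_inner M z (F N))"
      by (rule norm_triangle_ineq)
    also have "cmod (l2_inner M z (\<lambda>x. z x - F N x)) \<le> l2_norm M z * e N"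
      unfolding e_def by (rule l2_cauchy_schwarz[OF z l2_diff[OF z F]])
    also have "cmod (l2_inner M z (F N)) \<le> (1 + (l2_norm M (F N))\<^sup>2) / 2" by (rule test[OF N])
    also have "(l2_norm M (F N))\<^sup>2 \<le> (l2_norm M z + e N)\<^sup>2"
      using l2_norm_triangle[OF z l2_diff[OF F z], of N]
      by (intro power_mono) (simp_all add: e_def l2_norm_minus_commute[of M z])
    finally show ?thesis by simp
  qed
  have "(\<lambda>N. l2_norm M z * e N + (1 + (l2_norm M z + e N)\<^sup>2) / 2)
      \<longlonglongrightarrow> l2_norm M z * 0 + (1 + (l2_norm M z + 0)\<^sup>2) / 2"
    using lim unfolding e_def[symmetric] by (intro tendsto_intros)  auto
  from LIMSEQ_le_const[OF this, of "(l2_norm M z)\<^sup>2"] le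
  have "(l2_norm M z)\<^sup>2 \<le> (1 + (l2_norm M z)\<^sup>2) / 2" by auto
  hence "(l2_norm M z)\<^sup>2 \<le> 1" by simp
  thus ?thesis using power2_le_imp_le[of "l2_norm M z" 1] by simp
qed

section \<open>Cylinder neighbourhoods\<close>

text \<open>The same sets as \<open>cyl\<close>, but indexed by a point instead of a word, so that an inclusion of
  neighbourhoods is a statement about points.\<close>

definition nbhd :: "(nat, 'e) pre_digraph \<Rightarrow> nat \<Rightarrow> (int \<Rightarrow> 'e) \<Rightarrow> (int \<Rightarrow> 'e) set" where
  "nbhd G n x = {y \<in> sft G. \<forall>i\<in>set (window n). y i = x i}"

lemma window_eq: "window n = [1 - int ((n + 1) div 2)..int (n div 2)]"
proof (cases "odd n")
  case True
  then obtain m where "n = 2 * m + 1" by (rule oddE)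
  thus ?thesis by (simp add: window_def Let_def)
next
  case False
  then obtain m where "n = 2 * m" by auto
  thus ?thesis by (simp add: window_def Let_def)
qed

lemma div2_add: "n div 2 + (n + 1) div 2 = (n :: nat)"
  by presburger

lemma length_window [simp]: "length (window n) = n"
  using div2_add[of n] by (simp add: window_eq del: One_nat_def)

lemma set_window_mono: "m \<le> n \<Longrightarrow> set (window m) \<subseteq> set (window n)"
  using div_le_mono[of m n 2] div_le_mono[of "m + 1" "n + 1" 2]
  by (auto simp: window_eq simp del: One_nat_def)

lemma window_exhausts: "i \<in> set (window (2 * nat \<bar>i\<bar> + 1))"
  by (auto simp: window_eq)

text \<open>Relates the windows to the interval from 1 to \<open>n\<close> in which words are read.\<close>

lemma window_shift: "window n = map (\<lambda>i. i - int ((n + 1) div 2)) [1..int n]"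
  by (rule nth_equalityI) (use div2_add[of n] in \<open>auto simp: window_eq\<close>)

lemma cyl_eq_nbhd: "cyl G (map x (window n)) = nbhd G n x"
  by (auto simp: cyl_def nbhd_def)

lemma nbhd_self [simp]: "x \<in> sft G \<Longrightarrow> x \<in> nbhd G n x"
  by (simp add: nbhd_def)

lemma nbhd_subset_sft: "nbhd G n x \<subseteq> sft G"
  by (auto simp: nbhd_def)

lemma nbhd_antimono: "m \<le> n \<Longrightarrow> nbhd G n x \<subseteq> nbhd G m x"
  using set_window_mono[of m n] by (auto simp: nbhd_def)

lemma nbhd_eqI: "y \<in> nbhd G n x \<Longrightarrow> nbhd G n y = nbhd G n x"
  by (auto simp: nbhd_def)

lemma nbhd_subsetI: "m \<le> n \<Longrightarrow> x \<in> nbhd G m z \<Longrightarrow> nbhd G n x \<subseteq> nbhd G m z"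
  using nbhd_antimono[of m n G x] nbhd_eqI[of x G m z] by auto

lemma nbhd_disjointI:
  assumes "m \<le> n" "x \<notin> nbhd G m z" "x \<in> sft G"
  shows "nbhd G n x \<inter> nbhd G m z = {}"
proof (rule equals0I)
  fix y assume y: "y \<in> nbhd G n x \<inter> nbhd G m z"
  hence "nbhd G m y = nbhd G m x"
    using nbhd_antimono[OF assms(1), of G x] by (intro nbhd_eqI) auto
  moreover have "nbhd G m y = nbhd G m z" using y by (intro nbhd_eqI) auto
  ultimately show False using assms nbhd_self[of x G m] by auto
qed

lemma nbhd_separates:
  assumes "x \<noteq> y"
  shows "\<exists>N. \<forall>n\<ge>N. y \<notin> nbhd G n x"
proof -
  from assms obtain i where i: "y i \<noteq> x i" by (metis ext)
  have "y \<notin> nbhd G n x" if "n \<ge> 2 * nat \<bar>i\<bar> + 1" for n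
  proof -
    have "i \<in> set (window n)" using set_window_mono[OF that] window_exhausts[of i] by blast
    with i show ?thesis by (auto simp: nbhd_def)
  qed
  thus ?thesis by blast
qed

lemma nbhd_separates_finite:
  assumes "finite S"
  shows "\<exists>n. \<forall>x\<in>S. \<forall>y\<in>S. x \<noteq> y \<longrightarrow> y \<notin> nbhd G n x"
proof -
  from nbhd_separates[of _ _ G]
  obtain N where N: "\<And>x y n. x \<noteq> y \<Longrightarrow> n \<ge> N x y \<Longrightarrow> y \<notin> nbhd G n x"
    by metis
  have "N x y \<le> (\<Sum>p\<in>S \<times> S. N (fst p) (snd p))" if "x \<in> S" "y \<in> S" for x y
    using member_le_sum[of "(x, y)" "S \<times> S" "\<lambda>p. N (fst p) (snd p)"] assms that by auto
  thus ?thesis using N by blast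
qed

lemma sft_translate: "x \<in> sft G \<Longrightarrow> (\<lambda>i. x (i + p)) \<in> sft G"
  by (simp add: sft_def add.assoc add.commute[of p 1])

lemma words_eq: "words G n = (\<lambda>x. map x (window n)) ` sft G"
proof -
  define d where "d = int ((n + 1) div 2)"
  have w: "window n = map (\<lambda>i. i - d) [1..int n]" by (simp add: window_shift d_def)
  show ?thesis
  proof (intro equalityI subsetI)
    fix u assume "u \<in> words G n"
    then obtain x where x: "x \<in> sft G" "u = map x [1..int n]" by (auto simp: words_def)
    hence "u = map (\<lambda>i. x (i + d)) (window n)" by (simp add: w)
    thus "u \<in> (\<lambda>x. map x (window n)) ` sft G" using sft_translate[OF x(1)] by blast
  next
    fix u assume "u \<in> (\<lambda>x. map x (window n)) ` sft G"
    then obtain x where x: "x \<in> sft G" "u = map x (window n)" by auto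
    hence "u = map (\<lambda>i. x (i + - d)) [1..int n]" by (simp add: w)
    thus "u \<in> words G n" using sft_translate[OF x(1)] unfolding words_def by blast
  qed
qed

lemma finite_words:
  assumes "finite (arcs G)"
  shows "finite (words G n)"
proof (rule finite_subset)
  show "words G n \<subseteq> {u. set u \<subseteq> arcs G \<and> length u = n}"
    by (auto simp: words_def sft_def)
  show "finite {u. set u \<subseteq> arcs G \<and> length u = n}"
    by (rule finite_lists_length_eq[OF assms])
qed

section \<open>Locally constant functions\<close>

text \<open>Level 0 fits the pattern of the other levels: its only word is the empty one, whose cylinder
  is the whole space.\<close>

lemma level_eq:
  fixes G :: "(nat, 'a) pre_digraph"
  shows
  "level G (int n) = {\<lambda>x. \<Sum>w\<in>words G n. c w * indicator (cyl G w) x |c. True}"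
proof (cases "n = 0")
  case True
  have cyl: "cyl G [] = sft G" by (auto simp: cyl_def window_eq)
  show ?thesis
  proof (cases "sft G = {}")
    case True
    thus ?thesis using \<open>n = 0\<close> by (simp add: level_def words_def)
  next
    case False
    hence words: "words G 0 = {[]}" by (auto simp: words_def)
    have "(\<Sum>w\<in>words G 0. c w * indicator (cyl G w) x) = c [] * indicator (sft G) x"
      for c :: "'a list \<Rightarrow> complex" and x
      unfolding words by (subst sum.insert) (simp_all add: cyl)
    moreover have "level G 0 = {\<lambda>x. (d :: 'a list \<Rightarrow> complex) [] * indicator (sft G) x |d. True}"
      by (auto simp: level_def intro: exI[where x = "\<lambda>_. _"])
    ultimately show ?thesis using \<open>n = 0\<close> by simp
  qed
qed (auto simp: level_def)

text \<open>Membership in a level becomes a pointwise condition; products and inclusions of levels are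
  then immediate.\<close>

lemma level_iff:
  assumes fin: "finite (arcs G)"
  shows "f \<in> level G (int n) \<longleftrightarrow>
    (\<forall>x. x \<notin> sft G \<longrightarrow> f x = 0) \<and> (\<forall>x\<in>sft G. \<forall>y\<in>nbhd G n x. f y = f x)"
    (is "_ \<longleftrightarrow> ?R")
proof
  assume "f \<in> level G (int n)"
  then obtain c where f: "f = (\<lambda>x. \<Sum>w\<in>words G n. c w * indicator (cyl G w) x)"
    by (auto simp: level_eq)
  show ?R
  proof (intro conjI allI impI ballI)
    fix x assume "x \<notin> sft G"
    hence "indicator (cyl G w) x = (0 :: complex)" for w by (simp add: cyl_def)
    thus "f x = 0" unfolding f by simp
  next
    fix x y assume xy: "x \<in> sft G" "y \<in> nbhd G n x"
    have "indicator (cyl G w) y = (indicator (cyl G w) x :: complex)" if "w \<in> words G n" for w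
    proof -
      from that obtain v where "w = map v (window n)" by (auto simp: words_eq)
      with xy show ?thesis by (auto simp: cyl_eq_nbhd indicator_def nbhd_def)
    qed
    thus "f y = f x" unfolding f by (intro sum.cong refl) simp
  qed
next
  assume R: ?R
  define c where "c w = f (SOME x. x \<in> cyl G w)" for w
  have "f x = (\<Sum>w\<in>words G n. c w * indicator (cyl G w) x)" for x
  proof (cases "x \<in> sft G")
    case False
    hence "indicator (cyl G w) x = (0 :: complex)" for w by (simp add: cyl_def)
    moreover have "f x = 0" using R False by blast
    ultimately show ?thesis by simp
  next
    case True
    define v where "v = map x (window n)"
    have v: "v \<in> words G n" using True by (auto simp: words_eq v_def)
    have "c w * indicator (cyl G w) x = (if w = v then f x else 0)" if w: "w \<in> words G n" for w
    proof (cases "w = v")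
      case False
      have "length w = n" using w by (auto simp: words_def)
      with False have "x \<notin> cyl G w" by (auto simp: cyl_def v_def)
      with False show ?thesis by simp
    next
      case eq: True
      have cyl: "cyl G w = nbhd G n x" by (simp add: eq v_def cyl_eq_nbhd)
      have "(SOME y. y \<in> cyl G w) \<in> nbhd G n x"
        unfolding cyl by (rule someI[of _ x]) (simp add: True)
      hence "c w = f x" unfolding c_def using R True by blast
      moreover have "x \<in> cyl G w" unfolding cyl using True by simp
      ultimately show ?thesis using eq by simp
    qed
    hence "(\<Sum>w\<in>words G n. c w * indicator (cyl G w) x) = (\<Sum>w\<in>words G n. if w = v then f x else 0)"
      by (rule sum.cong[OF refl])
    also have "\<dots> = f x" using v finite_words[OF fin, of n] by simp
    finally show ?thesis by simp
  qed
  thus "f \<in> level G (int n)" unfolding level_eq by blast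
qed

lemma level_mono:
  assumes "finite (arcs G)" "f \<in> level G (int m)" "m \<le> n"
  shows "f \<in> level G (int n)"
  using assms(2) nbhd_antimono[OF assms(3), of G] unfolding level_iff[OF assms(1)] by blast

lemma level_pointwise:
  assumes fin: "finite (arcs G)" and f: "f \<in> level G (int n)" and g: "g \<in> level G (int n)"
    and p: "p 0 0 = (0 :: complex)"
  shows "(\<lambda>x. p (f x) (g x)) \<in> level G (int n)"
  unfolding level_iff[OF fin]
proof (intro conjI allI impI ballI)
  fix x assume "x \<notin> sft G"
  hence "f x = 0" "g x = 0" using f g unfolding level_iff[OF fin] by blast+
  thus "p (f x) (g x) = 0" using p by simp
next
  fix x y assume "x \<in> sft G" "y \<in> nbhd G n x"
  hence "f y = f x" "g y = g x" using f g unfolding level_iff[OF fin] by blast+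
  thus "p (f y) (g y) = p (f x) (g x)" by simp
qed

lemmas level_mult = level_pointwise[where p = "\<lambda>a b. a * b", simplified]
lemmas level_add = level_pointwise[where p = "\<lambda>a b. a + b", simplified]
lemmas level_diff = level_pointwise[where p = "\<lambda>a b. a - b", simplified]

lemma level_cmult:
  assumes "finite (arcs G)" "f \<in> level G (int n)"
  shows "(\<lambda>x. c * f x) \<in> level G (int n)"
  using level_pointwise[OF assms(1,2,2), of "\<lambda>a b. c * a"] by simp

lemma level_sum:
  assumes "finite (arcs G)" "\<And>k. k \<in> N \<Longrightarrow> f k \<in> level G (int n)"
  shows "(\<lambda>x. \<Sum>k\<in>N. f k x) \<in> level G (int n)"
  using assms(2)
proof (induction N rule: infinite_finite_induct)
  case (insert k N)
  thus ?case by (simp add: level_add[OF assms(1)])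
qed (simp_all add: level_iff[OF assms(1)])

lemma indicator_nbhd_level:
  assumes "finite (arcs G)"
  shows "indicator (nbhd G n z) \<in> level G (int n)"
  unfolding level_iff[OF assms] by (auto simp: nbhd_def indicator_def)

text \<open>Arbitrary finite sets of coordinates are admitted because translates of cylinders have to be
  measurable as well.\<close>

lemma cylinder_open:
  assumes "finite W"
  shows "openin (sft_topology G) {y \<in> sft G. \<forall>i\<in>W. y i = z i}"
proof -
  define S where "S i = (if i \<in> W then {z i} \<inter> arcs G else arcs G)" for i
  have "openin (product_topology (\<lambda>_. discrete_topology (arcs G)) UNIV) (PiE UNIV S)"
  proof -
    have "finite {i \<in> UNIV. S i \<noteq> topspace (discrete_topology (arcs G))}"
      by (rule finite_subset[OF _ assms]) (auto simp: S_def)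
    thus ?thesis by (auto simp: openin_PiE_gen S_def)
  qed
  moreover have "{y \<in> sft G. \<forall>i\<in>W. y i = z i} = PiE UNIV S \<inter> sft G"
    by (auto simp: S_def PiE_iff sft_def split: if_splits)
  ultimately show ?thesis unfolding sft_topology_def openin_subtopology by blast
qed

lemma space_sft_borel: "space (sft_borel G) = sft G"
  by (simp add: sft_borel_def space_measure_of_conv)

lemma cylinder_borel:
  assumes "finite W"
  shows "{y \<in> sft G. \<forall>i\<in>W. y i = z i} \<in> sets (sft_borel G)"
proof -
  have "{V. openin (sft_topology G) V} \<subseteq> Pow (sft G)"
    by (auto simp: sft_topology_def openin_subtopology)
  hence "sets (sft_borel G) = sigma_sets (sft G) {V. openin (sft_topology G) V}"
    unfolding sft_borel_def by (rule sets_measure_of)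
  thus ?thesis using cylinder_open[OF assms, of G z] by (auto intro: sigma_sets.Basic)
qed

lemma nbhd_borel: "nbhd G n z \<in> sets (sft_borel G)"
  unfolding nbhd_def by (rule cylinder_borel) simp

lemma point_evaluation_is_state: "z \<in> sft G \<Longrightarrow> is_state G (\<lambda>f. f z)"
  by (simp add: is_state_def)

section \<open>The Dirac operator in terms of cylinder averages\<close>

text \<open>Positivity on cylinders makes the averages below well defined.\<close>

locale sft_prob = prob_space M
  for M :: "(int \<Rightarrow> 'e) measure" +
  fixes G :: "(nat, 'e) pre_digraph"
  assumes finite_arcs: "finite (arcs G)"
    and sets_M: "sets M = sets (sft_borel G)"
    and nbhd_pos: "x \<in> sft G \<Longrightarrow> 0 < prob (nbhd G n x)"
begin

lemma nbhd_sets [measurable, simp]: "nbhd G n z \<in> sets M"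
  by (simp add: sets_M nbhd_borel)

lemma indicator_nbhd_l2: "indicator (nbhd G n z) \<in> l2 M"
proof -
  have "integrable M (\<lambda>x. (cmod (indicator (nbhd G n z) x))\<^sup>2)"
    by (rule integrable_const_bound[of _ 1]) (auto simp: indicator_def)
  thus ?thesis by (simp add: l2_def)
qed

lemma level_l2:
  assumes "f \<in> level G (int n)"
  shows "f \<in> l2 M"
proof -
  from assms obtain c where f: "f = (\<lambda>x. \<Sum>w\<in>words G n. c w * indicator (cyl G w) x)"
    by (auto simp: level_eq)
  show ?thesis unfolding f
  proof (intro l2_sum l2_cmult)
    fix w assume "w \<in> words G n"
    then obtain v where "w = map v (window n)" by (auto simp: words_eq)
    thus "indicator (cyl G w) \<in> l2 M" by (simp add: cyl_eq_nbhd indicator_nbhd_l2)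
  qed
qed

lemma level_perp_l2: "f \<in> level_perp G M n \<Longrightarrow> f \<in> l2 M"
  by (auto simp: level_perp_def intro: level_l2)

subsection \<open>Averaging over cylinders\<close>

text \<open>The orthogonal projection of \<open>L\<^sup>2\<close> onto the functions of level \<open>n\<close>: the conditional
  expectation with respect to the partition into cylinders of level \<open>n\<close>. The inner product is
  antilinear in its second argument, so the function to be averaged comes first.\<close>

definition average :: "nat \<Rightarrow> ((int \<Rightarrow> 'e) \<Rightarrow> complex) \<Rightarrow> (int \<Rightarrow> 'e) \<Rightarrow> complex" where
  "average n f x = (if x \<in> sft G
     then l2_inner M f (indicator (nbhd G n x)) / of_real (prob (nbhd G n x)) else 0)"

lemma average_level: "average n f \<in> level G (int n)"
proof -
  have "average n f y = average n f x" if "x \<in> sft G" "y \<in> nbhd G n x" for x y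
    using that nbhd_eqI[OF that(2)] nbhd_subset_sft[of G n x] by (auto simp: average_def)
  thus ?thesis unfolding level_iff[OF finite_arcs] by (auto simp: average_def)
qed

lemma l2_inner_commute: "l2_inner M f g = cnj (l2_inner M g f)"
  unfolding l2_inner_def Bochner_Integration.integral_cnj[symmetric]
  by (simp add: mult.commute)

text \<open>Together with \<open>average_level\<close>, this says that averaging is the orthogonal projection. It is
  enough to check it on indicator functions of cylinders, on which the average is constant.\<close>

lemma l2_inner_average:
  assumes c: "c \<in> level G (int n)" and f: "f \<in> l2 M"
  shows "l2_inner M c (average n f) = l2_inner M c f"
proof -
  from c obtain d where d: "c = (\<lambda>x. \<Sum>w\<in>words G n. d w * indicator (cyl G w) x)"
    by (auto simp: level_eq)
  have l2: "indicator (cyl G w) \<in> l2 M"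
    and eq: "l2_inner M (indicator (cyl G w)) (average n f) = l2_inner M (indicator (cyl G w)) f"
    if "w \<in> words G n" for w
  proof -
    from that obtain v where v: "v \<in> sft G" and w: "w = map v (window n)" by (auto simp: words_eq)
    define U where "U = nbhd G n v"
    define a where "a = l2_inner M f (indicator U)"
    have cyl: "cyl G w = U" by (simp add: w cyl_eq_nbhd U_def)
    show "indicator (cyl G w) \<in> l2 M" by (simp add: cyl U_def indicator_nbhd_l2)
    have "l2_inner M (indicator U) (average n f)
        = (LINT y|M. of_real (indicator U y) * (cnj a / of_real (prob U)))"
      unfolding l2_inner_def
    proof (intro Bochner_Integration.integral_cong refl)
      fix y
      have "average n f y = a / of_real (prob U)" if "y \<in> U"
        using that nbhd_eqI[of y G n v] nbhd_subset_sft[of G n v]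
        by (auto simp: average_def a_def U_def)
      thus "indicator U y * cnj (average n f y) = of_real (indicator U y) * (cnj a / of_real (prob U))"
        by (cases "y \<in> U") simp_all
    qed
    also have "\<dots> = of_real (LINT y|M. indicator U y) * (cnj a / of_real (prob U))"
      by (simp only: integral_mult_left_zero integral_complex_of_real)
    also have "(LINT y|M. indicator U y) = prob U" by (simp add: U_def)
    also have "of_real (prob U) * (cnj a / of_real (prob U)) = cnj a"
      using nbhd_pos[OF v, of n] by (simp add: U_def)
    also have "cnj a = l2_inner M (indicator U) f"
      unfolding a_def by (rule l2_inner_commute[symmetric])
    finally show "l2_inner M (indicator (cyl G w)) (average n f) = l2_inner M (indicator (cyl G w)) f"
      by (simp add: cyl)
  qed
  show ?thesis unfolding d
    by (simp add: l2_inner_sum_left l2_cmult l2 f level_l2[OF average_level] l2_inner_cmult_left eq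
        cong: sum.cong)
qed

text \<open>Components above level \<open>j\<close> are orthogonal to \<open>\<psi>\<close>, so the series is a finite sum.\<close>

lemma l2_inner_expansion:
  assumes h: "h \<in> l2 M" and c: "\<And>n. c n \<in> level_perp G M n" and sums: "l2_sums M c h"
    and \<psi>: "\<psi> \<in> level G (int j)"
  shows "l2_inner M h \<psi> = (\<Sum>n\<le>j. l2_inner M (c n) \<psi>)"
proof -
  have "(\<lambda>N. l2_inner M (\<lambda>x. \<Sum>n<N. c n x) \<psi>) \<longlonglongrightarrow> l2_inner M h \<psi>"
    using sums by (intro l2_inner_tendsto h level_l2[OF \<psi>] l2_sum level_perp_l2[OF c])
      (simp add: l2_sums_def)
  moreover have "l2_inner M (\<lambda>x. \<Sum>n<N. c n x) \<psi> = (\<Sum>n\<le>j. l2_inner M (c n) \<psi>)" if N: "N \<ge> Suc j" for N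
  proof -
    have orth: "l2_inner M (c n) \<psi> = 0" if "n > j" for n
    proof -
      have "\<psi> \<in> level G (int (n - 1))" using level_mono[OF finite_arcs \<psi>, of "n - 1"] that by simp
      hence "\<psi> \<in> level G (int n - 1)" using that by (simp add: of_nat_diff)
      thus ?thesis using c[of n] by (simp add: level_perp_def)
    qed
    have "l2_inner M (\<lambda>x. \<Sum>n<N. c n x) \<psi> = (\<Sum>n<N. l2_inner M (c n) \<psi>)"
      by (intro l2_inner_sum_left level_perp_l2[OF c] level_l2[OF \<psi>])
    also have "\<dots> = (\<Sum>n\<le>j. l2_inner M (c n) \<psi>)"
      using N by (intro sum.mono_neutral_right) (auto intro: orth)
    finally show ?thesis .
  qed
  hence "(\<lambda>N. l2_inner M (\<lambda>x. \<Sum>n<N. c n x) \<psi>) \<longlonglongrightarrow> (\<Sum>n\<le>j. l2_inner M (c n) \<psi>)"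
    by (intro tendsto_eventually eventually_sequentiallyI[of "Suc j"])
  ultimately show ?thesis by (rule LIMSEQ_unique)
qed

text \<open>This is the identity \<open>D = \<Sum>\<^sub>j (1 - E\<^sub>j)\<close>, where \<open>E\<^sub>j\<close> is the projection onto the
  \<open>j\<close>-th level: a vector of the \<open>n\<close>-th eigenspace is killed by \<open>1 - E\<^sub>j\<close> for \<open>j \<ge> n\<close> and
  fixed by the \<open>n\<close> operators with \<open>j < n\<close>. Tested against a locally constant function, the
  sum is finite.\<close>

lemma dirac_inner:
  assumes D: "dirac G M h g" and \<phi>: "\<phi> \<in> level G (int N)"
  shows "l2_inner M g \<phi> = (\<Sum>j<N. l2_inner M h \<phi> - l2_inner M h (average j \<phi>))"
proof -
  from D obtain c where h: "h \<in> l2 M" and g: "g \<in> l2 M" and c: "\<And>n. c n \<in> level_perp G M n"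
    and sums: "l2_sums M c h" "l2_sums M (\<lambda>n x. of_nat n * c n x) g"
    by (auto simp: dirac_def)
  define b where "b n = l2_inner M (c n) \<phi>" for n
  have c': "(\<lambda>x. of_nat n * c n x) \<in> level_perp G M n" for n
    using c[of n] level_cmult[OF finite_arcs] by (auto simp: level_perp_def l2_inner_cmult_left)
  have "l2_inner M g \<phi> = (\<Sum>n\<le>N. of_nat n * b n)"
    using l2_inner_expansion[OF g c' sums(2) \<phi>] by (simp add: l2_inner_cmult_left b_def)
  \<comment> \<open>Summation by parts: \<open>b n\<close> survives in the summands with \<open>j < n\<close>.\<close>
  also have "\<dots> = (\<Sum>j<N. (\<Sum>n\<le>N. b n) - (\<Sum>n\<le>j. b n))"
  proof (induction N)
    case (Suc N)
    have "(\<Sum>j<N. (\<Sum>n\<le>N. b n) + b (Suc N) - (\<Sum>n\<le>j. b n))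
        = of_nat N * b (Suc N) + (\<Sum>j<N. (\<Sum>n\<le>N. b n) - (\<Sum>n\<le>j. b n))"
      by (simp add: sum.distrib sum_subtractf algebra_simps)
    with Suc show ?case by (simp add: algebra_simps)
  qed simp
  also have "\<dots> = (\<Sum>j<N. l2_inner M h \<phi> - l2_inner M h (average j \<phi>))"
  proof (intro sum.cong refl arg_cong2[where f = "(-)"])
    show "(\<Sum>n\<le>N. b n) = l2_inner M h \<phi>"
      unfolding b_def by (rule l2_inner_expansion[OF h c sums(1) \<phi>, symmetric])
  next
    fix j
    have cj: "c n \<in> level G (int j)" if "n \<le> j" for n
      using c[of n] level_mono[OF finite_arcs _ that] by (auto simp: level_perp_def)
    have "l2_inner M h (average j \<phi>) = (\<Sum>n\<le>j. l2_inner M (c n) (average j \<phi>))"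
      by (rule l2_inner_expansion[OF h c sums(1) average_level])
    also have "\<dots> = (\<Sum>n\<le>j. b n)"
      unfolding b_def using cj level_l2[OF \<phi>] by (intro sum.cong refl l2_inner_average) auto
    finally show "(\<Sum>n\<le>j. b n) = l2_inner M h (average j \<phi>)" ..
  qed
  finally show ?thesis .
qed

subsection \<open>The commutator with a tower of nested cylinders\<close>

definition tower :: "(int \<Rightarrow> 'e) \<Rightarrow> nat \<Rightarrow> (int \<Rightarrow> 'e) \<Rightarrow> complex" where
  "tower z K x = (\<Sum>k\<in>{1..K}. indicator (nbhd G k z) x)"

lemma tower_level:
  assumes "K \<le> N"
  shows "tower z K \<in> level G (int N)"
  unfolding tower_def[abs_def]
  using assms by (intro level_sum[OF finite_arcs] level_mono[OF finite_arcs indicator_nbhd_level[OF finite_arcs]]) auto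

lemma tower_bounded: "cmod (tower z K x) \<le> real K"
proof -
  have "cmod (tower z K x) \<le> (\<Sum>k\<in>{1..K}. 1)"
    unfolding tower_def by (intro sum_norm_le) (auto simp: indicator_def)
  thus ?thesis by simp
qed

text \<open>If \<open>k \<le> j\<close>, the indicator function is constant on cylinders of level \<open>j\<close> and commutes with
  averaging over them. If \<open>j < k\<close>, the cylinder of level \<open>k\<close> lies in a single cylinder of level \<open>j\<close>,
  so both products are explicit.\<close>

lemma average_nbhd_commutator:
  assumes \<phi>: "\<phi> \<in> l2 M" and z: "z \<in> sft G" and x: "x \<in> sft G"
  defines "I \<equiv> \<lambda>k. l2_inner M \<phi> (indicator (nbhd G k z))"
  shows "average j (\<lambda>y. indicator (nbhd G k z) y * \<phi> y) x - indicator (nbhd G k z) x * average j \<phi> x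
    = (if j < k then (I k * indicator (nbhd G j z) x - I j * indicator (nbhd G k z) x)
          / of_real (prob (nbhd G j z)) else 0)"
proof -
  have inter: "l2_inner M (\<lambda>y. indicator (nbhd G k z) y * \<phi> y) (indicator (nbhd G j x))
      = (LINT y|M. \<phi> y * indicator (nbhd G k z \<inter> nbhd G j x) y)"
    unfolding l2_inner_def by (intro Bochner_Integration.integral_cong) (auto simp: indicator_def)
  have inner_ind: "l2_inner M \<phi> (indicator U) = (LINT y|M. \<phi> y * indicator U y)" for U
    unfolding l2_inner_def by (intro Bochner_Integration.integral_cong) (auto simp: indicator_def)
  show ?thesis
  proof (cases "j < k")
    case False
    hence jk: "k \<le> j" by simp
    show ?thesis
    proof (cases "x \<in> nbhd G k z")
      case True
      hence "nbhd G k z \<inter> nbhd G j x = nbhd G j x" using nbhd_subsetI[OF jk True] by blast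
      thus ?thesis using False True x by (simp add: average_def inter inner_ind)
    next
      case notin: False
      have "nbhd G k z \<inter> nbhd G j x = {}" using nbhd_disjointI[OF jk notin x] by blast
      thus ?thesis using False notin x by (simp add: average_def inter)
    qed
  next
    case True
    hence jk: "j \<le> k" by simp
    show ?thesis
    proof (cases "x \<in> nbhd G j z")
      case True
      have eq: "nbhd G j x = nbhd G j z" by (rule nbhd_eqI[OF True])
      have "nbhd G k z \<inter> nbhd G j x = nbhd G k z"
        unfolding eq using nbhd_antimono[OF jk, of G z] by blast
      hence "l2_inner M (\<lambda>y. indicator (nbhd G k z) y * \<phi> y) (indicator (nbhd G j z)) = I k"
        using inter by (simp only: I_def inner_ind eq)
      thus ?thesis using True \<open>j < k\<close> x by (simp add: average_def I_def eq diff_divide_distrib)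
    next
      case notin: False
      have "nbhd G j x \<inter> nbhd G j z = {}" using nbhd_disjointI[OF order_refl notin x] .
      hence "nbhd G k z \<inter> nbhd G j x = {}" using nbhd_antimono[OF jk, of G z] by blast
      moreover have "x \<notin> nbhd G k z" using nbhd_antimono[OF jk, of G z] notin by blast
      ultimately show ?thesis using notin \<open>j < k\<close> x by (simp add: average_def inter)
    qed
  qed
qed

lemma tower_commutator:
  assumes \<phi>: "\<phi> \<in> l2 M" and z: "z \<in> sft G"
  defines "I \<equiv> \<lambda>k. l2_inner M \<phi> (indicator (nbhd G k z))"
  shows "average j (\<lambda>y. tower z K y * \<phi> y) x - tower z K x * average j \<phi> x
    = (\<Sum>k\<in>{1..K}. if j < k then (I k * indicator (nbhd G j z) x - I j * indicator (nbhd G k z) x)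
          / of_real (prob (nbhd G j z)) else 0)"
proof (cases "x \<in> sft G")
  case True
  have l2: "(\<lambda>y. indicator (nbhd G k z) y * \<phi> y) \<in> l2 M" for k
    by (rule l2_bounded_mult(1)[OF \<phi>, where B = 1]) (auto simp: indicator_def)
  have "average j (\<lambda>y. tower z K y * \<phi> y) x
      = (\<Sum>k\<in>{1..K}. average j (\<lambda>y. indicator (nbhd G k z) y * \<phi> y) x)"
    using True
    by (simp only: average_def tower_def sum_distrib_right if_True l2_inner_sum_left[OF l2 indicator_nbhd_l2]
        sum_divide_distrib)
  thus ?thesis
    using average_nbhd_commutator[OF \<phi> z True, of j]
    by (simp only: I_def tower_def sum_distrib_right sum_subtractf[symmetric])
next
  case False
  hence "x \<notin> nbhd G k z" for k using nbhd_subset_sft[of G k z] by blast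
  thus ?thesis using False by (simp add: average_def tower_def)
qed

end

section \<open>Towers of geometrically shrinking cylinders\<close>

lemma sum_distinct_powers_le:
  fixes q :: real
  assumes q: "0 \<le> q" "q < 1" and J: "finite J" "inj_on e J"
  shows "(\<Sum>j\<in>J. q ^ e j) \<le> 1 / (1 - q)"
proof -
  have "(\<Sum>j\<in>J. q ^ e j) = (\<Sum>d\<in>e ` J. q ^ d)" by (simp add: sum.reindex[OF J(2)])
  also have "\<dots> \<le> (\<Sum>d. q ^ d)" using q J(1) by (intro sum_le_suminf summable_geometric) auto
  also have "\<dots> = 1 / (1 - q)" using q by (simp add: suminf_geometric)
  finally show ?thesis .
qed

lemma sum_power_distance_le:
  fixes q :: real
  assumes q: "0 \<le> q" "q < 1"
  shows "(\<Sum>j\<le>L. q ^ ((i - j) + (j - i))) \<le> 2 / (1 - q)"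
proof -
  have "(\<Sum>j\<le>L. q ^ ((i - j) + (j - i)))
      = (\<Sum>j\<in>{..L} \<inter> {..i}. q ^ ((i - j) + (j - i))) + (\<Sum>j\<in>{..L} - {..i}. q ^ ((i - j) + (j - i)))"
    by (rule sum.Int_Diff) simp
  also have "\<dots> \<le> 1 / (1 - q) + 1 / (1 - q)"
    by (intro add_mono sum_distinct_powers_le q) (auto simp: inj_on_def)
  finally show ?thesis by simp
qed

text \<open>Schur's test for the matrix \<open>q\<^bsup>|i - j|\<^esup>\<close>, whose row and column sums are bounded.\<close>

lemma power_distance_form_le:
  fixes q :: real
  assumes q: "0 \<le> q" "q < 1"
  shows "(\<Sum>i\<le>L. \<Sum>j\<le>L. q ^ ((i - j) + (j - i)) * (x i * y j))
    \<le> ((\<Sum>i\<le>L. (x i)\<^sup>2) + (\<Sum>i\<le>L. (y i)\<^sup>2)) / (1 - q)"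
proof -
  define d where "d i j = q ^ ((i - j) + (j - i))" for i j :: nat
  have d: "0 \<le> d i j" "d i j = d j i" for i j using q by (simp_all add: d_def add.commute)
  have row: "(\<Sum>j\<le>L. d i j) \<le> 2 / (1 - q)" for i unfolding d_def by (rule sum_power_distance_le[OF q])
  have half: "(\<Sum>i\<le>L. \<Sum>j\<le>L. d i j * ((u i)\<^sup>2 / 2)) \<le> (\<Sum>i\<le>L. (u i)\<^sup>2) / (1 - q)" for u
  proof -
    have "(\<Sum>i\<le>L. \<Sum>j\<le>L. d i j * ((u i)\<^sup>2 / 2)) = (\<Sum>i\<le>L. (\<Sum>j\<le>L. d i j) * ((u i)\<^sup>2 / 2))"
      by (simp only: sum_distrib_right)
    also have "\<dots> \<le> (\<Sum>i\<le>L. 2 / (1 - q) * ((u i)\<^sup>2 / 2))"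
      by (intro sum_mono mult_right_mono row) auto
    also have "\<dots> = (\<Sum>i\<le>L. (u i)\<^sup>2) / (1 - q)"
      unfolding sum_divide_distrib using q by (intro sum.cong refl) (simp add: divide_simps)
    finally show ?thesis .
  qed
  have "(\<Sum>i\<le>L. \<Sum>j\<le>L. d i j * (x i * y j))
      \<le> (\<Sum>i\<le>L. \<Sum>j\<le>L. d i j * ((x i)\<^sup>2 / 2) + d j i * ((y j)\<^sup>2 / 2))"
  proof (intro sum_mono)
    fix i j
    have "d i j * (x i * y j) \<le> d i j * ((x i)\<^sup>2 / 2 + (y j)\<^sup>2 / 2)"
      using sum_squares_bound[of "x i" "y j"] d(1) by (intro mult_left_mono) auto
    thus "d i j * (x i * y j) \<le> d i j * ((x i)\<^sup>2 / 2) + d j i * ((y j)\<^sup>2 / 2)"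
      by (simp only: d(2)[of j i] distrib_left)
  qed
  also have "\<dots> = (\<Sum>i\<le>L. \<Sum>j\<le>L. d i j * ((x i)\<^sup>2 / 2)) + (\<Sum>i\<le>L. \<Sum>j\<le>L. d i j * ((y i)\<^sup>2 / 2))"
    using sum.swap[of "\<lambda>i j. d j i * ((y j)\<^sup>2 / 2)" "{..L}" "{..L}"] by (simp add: sum.distrib)
  also have "\<dots> \<le> (\<Sum>i\<le>L. (x i)\<^sup>2) / (1 - q) + (\<Sum>i\<le>L. (y i)\<^sup>2) / (1 - q)"
    by (intro add_mono half)
  finally show ?thesis by (simp add: d_def add_divide_distrib)
qed

text \<open>Only the cylinders around the one point \<open>z\<close> are required to shrink geometrically. The square
  roots are the \<open>L\<^sup>2\<close> norms of their indicator functions.\<close>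

locale decaying_tower = sft_prob M G
  for M :: "(int \<Rightarrow> 'e) measure" and G :: "(nat, 'e) pre_digraph" +
  fixes z :: "int \<Rightarrow> 'e" and \<kappa> q :: real
  assumes z: "z \<in> sft G"
    and q: "0 \<le> q" "q < 1"
    and decay: "i \<le> j \<Longrightarrow>
      sqrt (prob (nbhd G j z)) \<le> \<kappa> * q ^ (j - i) * sqrt (prob (nbhd G i z))"
begin

definition ind_norm :: "nat \<Rightarrow> real" where
  "ind_norm k = sqrt (prob (nbhd G k z))"

text \<open>The inner product of \<open>|h|\<close> with the normalised indicator function of the \<open>k\<close>-th cylinder.\<close>

definition mass :: "((int \<Rightarrow> 'e) \<Rightarrow> complex) \<Rightarrow> nat \<Rightarrow> real" where
  "mass h k = (LINT x|M. cmod (h x) * indicator (nbhd G k z) x) / ind_norm k"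

text \<open>A bound for the row sums of the Gram matrix of the normalised indicator functions.\<close>

definition tower_const :: real where
  "tower_const = 2 * \<kappa> / (1 - q)"

lemma ind_norm_pos: "0 < ind_norm k"
  using nbhd_pos[OF z] by (simp add: ind_norm_def)

lemma ind_norm_square: "ind_norm k * ind_norm k = prob (nbhd G k z)"
  by (simp add: ind_norm_def)

lemma ind_norm_ratio: "i \<le> j \<Longrightarrow> ind_norm j / ind_norm i \<le> \<kappa> * q ^ (j - i)"
  using decay[of i j] ind_norm_pos[of i] by (simp add: ind_norm_def[symmetric] divide_le_eq)

lemma kappa_ge_1: "1 \<le> \<kappa>"
  using ind_norm_ratio[of 0 0] ind_norm_pos[of 0] by simp

lemma tower_const_pos: "0 < tower_const"
  using kappa_ge_1 q by (simp add: tower_const_def)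

lemma mass_nonneg: "0 \<le> mass h k"
  unfolding mass_def using ind_norm_pos[of k]
  by (intro divide_nonneg_nonneg integral_nonneg_AE AE_I2) auto

lemma integrable_cmod_nbhd:
  assumes "h \<in> l2 M"
  shows "integrable M (\<lambda>x. cmod (h x) * indicator (nbhd G k z) x)"
proof -
  have "cmod (indicator (nbhd G k z) x) = indicator (nbhd G k z) x" for x
    by (simp add: indicator_def)
  thus ?thesis using l2_mult_integrable(1)[OF assms indicator_nbhd_l2, of k z] by simp
qed

lemma l2_inner_nbhd_le:
  shows "cmod (l2_inner M h (indicator (nbhd G k z))) \<le> ind_norm k * mass h k"
proof -
  have "cmod (h x * cnj (indicator (nbhd G k z) x)) = cmod (h x) * indicator (nbhd G k z) x" for x
    by (simp add: indicator_def)
  hence "cmod (l2_inner M h (indicator (nbhd G k z)))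
      \<le> (LINT x|M. cmod (h x) * indicator (nbhd G k z) x)"
    unfolding l2_inner_def using integral_norm_bound[of M "\<lambda>x. h x * cnj (indicator (nbhd G k z) x)"]
    by simp
  thus ?thesis using ind_norm_pos[of k] by (simp add: mass_def)
qed

text \<open>The normalised indicator functions of the cylinders of the tower are almost orthogonal:
  their Gram matrix decays geometrically off the diagonal. Hence they satisfy Bessel's inequality
  up to a constant. The proof expands the square of \<open>|h| - C\<^sup>-\<^sup>1 \<Sum>\<^sub>k mass\<^sub>k e\<^sub>k\<close>, where
  \<open>e\<^sub>k\<close> are the normalised indicator functions.\<close>

lemma bessel_tower:
  assumes h: "h \<in> l2 M"
  shows "(\<Sum>k\<le>L. (mass h k)\<^sup>2) \<le> tower_const * (l2_norm M h)\<^sup>2"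
proof -
  define A where "A = mass h"
  define e where "e k x = indicator (nbhd G k z) x / ind_norm k" for k x
  define S where "S = (\<Sum>k\<le>L. (A k)\<^sup>2)"
  \<comment> \<open>This value minimises the upper bound \<open>\<parallel>h\<parallel>\<^sup>2 - 2 t S + t\<^sup>2 C S\<close> obtained below, where \<open>C\<close> is
    the constant of the tower.\<close>
  define t where "t = 1 / tower_const"
  have int_h: "integrable M (\<lambda>x. (cmod (h x))\<^sup>2)" using h by (simp add: l2_def)
  have int_he: "integrable M (\<lambda>x. cmod (h x) * e k x)" for k
    using integrable_cmod_nbhd[OF h, of k] by (simp add: e_def)
  have "indicator (nbhd G i z) x * indicator (nbhd G j z) x
      = (indicator (nbhd G (max i j) z) x :: real)" for i j x
    using nbhd_antimono[of i j G z] nbhd_antimono[of j i G z]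
    by (cases "i \<le> j") (auto simp: indicator_def max_def)
  hence ee: "e i x * e j x = indicator (nbhd G (max i j) z) x / (ind_norm i * ind_norm j)" for i j x
    by (simp add: e_def)
  have int_ee: "integrable M (\<lambda>x. e i x * e j x)" for i j
    unfolding ee by (intro integrable_divide_zero integrable_real_indicator) (auto simp: emeasure_eq_measure)
  have he: "(LINT x|M. cmod (h x) * e k x) = A k" for k
    by (simp add: e_def A_def mass_def)
  have gram: "(LINT x|M. e i x * e j x) \<le> \<kappa> * q ^ ((i - j) + (j - i))" for i j
  proof -
    have "(LINT x|M. e i x * e j x) = ind_norm (max i j) * ind_norm (max i j) / (ind_norm i * ind_norm j)"
      unfolding ee by (simp add: ind_norm_square)
    also have "\<dots> = ind_norm (max i j) / ind_norm (min i j)"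
      using ind_norm_pos by (auto simp: max_def min_def less_imp_neq[symmetric])
    also have "\<dots> \<le> \<kappa> * q ^ (max i j - min i j)" by (rule ind_norm_ratio) simp
    also have "max i j - min i j = (i - j) + (j - i)" by (auto simp: max_def min_def)
    finally show ?thesis .
  qed
  have "0 \<le> (LINT x|M. (cmod (h x) - t * (\<Sum>k\<le>L. A k * e k x))\<^sup>2)"
    by (intro integral_nonneg_AE AE_I2) auto
  also have "\<dots> = (LINT x|M. (cmod (h x))\<^sup>2 - 2 * t * (\<Sum>k\<le>L. A k * (cmod (h x) * e k x))
      + t\<^sup>2 * (\<Sum>i\<le>L. \<Sum>j\<le>L. A i * A j * (e i x * e j x)))"
  proof (intro Bochner_Integration.integral_cong refl)
    fix x
    define s where "s = (\<Sum>k\<le>L. A k * e k x)"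
    have 1: "(\<Sum>k\<le>L. A k * (cmod (h x) * e k x)) = cmod (h x) * s"
      unfolding s_def sum_distrib_left by (intro sum.cong refl) (simp add: mult_ac)
    have 2: "(\<Sum>i\<le>L. \<Sum>j\<le>L. A i * A j * (e i x * e j x)) = s\<^sup>2"
      unfolding s_def power2_eq_square sum_product by (intro sum.cong refl) (simp add: mult_ac)
    show "(cmod (h x) - t * (\<Sum>k\<le>L. A k * e k x))\<^sup>2 = (cmod (h x))\<^sup>2
        - 2 * t * (\<Sum>k\<le>L. A k * (cmod (h x) * e k x))
        + t\<^sup>2 * (\<Sum>i\<le>L. \<Sum>j\<le>L. A i * A j * (e i x * e j x))"
      unfolding 1 2 s_def[symmetric] by (simp add: power2_eq_square algebra_simps)
  qed
  also have "\<dots> = (l2_norm M h)\<^sup>2 - 2 * t * (\<Sum>k\<le>L. A k * A k)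
      + t\<^sup>2 * (\<Sum>i\<le>L. \<Sum>j\<le>L. A i * A j * (LINT x|M. e i x * e j x))"
    using int_h int_he int_ee by (simp add: l2_norm_square he)
  also have "(\<Sum>i\<le>L. \<Sum>j\<le>L. A i * A j * (LINT x|M. e i x * e j x)) \<le> tower_const * S"
  proof -
    have "(\<Sum>i\<le>L. \<Sum>j\<le>L. A i * A j * (LINT x|M. e i x * e j x))
        \<le> (\<Sum>i\<le>L. \<Sum>j\<le>L. A i * A j * (\<kappa> * q ^ ((i - j) + (j - i))))"
      by (intro sum_mono mult_left_mono gram) (simp add: A_def mass_nonneg)
    also have "\<dots> = \<kappa> * (\<Sum>i\<le>L. \<Sum>j\<le>L. q ^ ((i - j) + (j - i)) * (A i * A j))"
      unfolding sum_distrib_left by (intro sum.cong refl) (simp add: mult_ac)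
    also have "\<dots> \<le> \<kappa> * ((S + S) / (1 - q))"
      unfolding S_def using kappa_ge_1 by (intro mult_left_mono power_distance_form_le q) auto
    finally show ?thesis by (simp add: tower_const_def field_simps)
  qed
  finally have "0 \<le> (l2_norm M h)\<^sup>2 - 2 * t * S + t\<^sup>2 * (tower_const * S)"
    by (simp add: S_def power2_eq_square mult_left_mono)
  also have "\<dots> = (l2_norm M h)\<^sup>2 - S / tower_const"
    using tower_const_pos by (simp add: t_def power2_eq_square)
  finally show ?thesis using tower_const_pos by (simp add: S_def A_def field_simps)
qed

text \<open>In terms of the normalised indicator functions, the coefficients of the rank two operator for
  \<open>j < k\<close> carry the factor \<open>\<parallel>1\<^bsub>U\<^sub>k\<^esub>\<parallel> / \<parallel>1\<^bsub>U\<^sub>j\<^esub>\<parallel>\<close>, which decays with \<open>k - j\<close>.\<close>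

lemma commutator_term_le:
  assumes jk: "j \<le> k" and h: "h \<in> l2 M"
  shows "cmod (l2_inner M h (\<lambda>x. (l2_inner M \<phi> (indicator (nbhd G k z)) * indicator (nbhd G j z) x
        - l2_inner M \<phi> (indicator (nbhd G j z)) * indicator (nbhd G k z) x)
      / of_real (prob (nbhd G j z))))
    \<le> \<kappa> * q ^ ((j - k) + (k - j)) * (mass h j * mass \<phi> k + mass \<phi> j * mass h k)"
proof -
  define I where "I k = l2_inner M \<phi> (indicator (nbhd G k z))" for k
  define H where "H k = l2_inner M h (indicator (nbhd G k z))" for k
  define p where "p = prob (nbhd G j z)"
  have "l2_inner M h (\<lambda>x. (I k * indicator (nbhd G j z) x - I j * indicator (nbhd G k z) x) / of_real p)
      = (cnj (I k) * H j - cnj (I j) * H k) / of_real p"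
  proof -
    have "l2_inner M h (\<lambda>x. (I k * indicator (nbhd G j z) x - I j * indicator (nbhd G k z) x) / of_real p)
        = (LINT x|M. (cnj (I k) * (h x * cnj (indicator (nbhd G j z) x))
            - cnj (I j) * (h x * cnj (indicator (nbhd G k z) x))) / of_real p)"
      unfolding l2_inner_def by (intro Bochner_Integration.integral_cong) (simp_all add: algebra_simps)
    also have "\<dots> = (cnj (I k) * H j - cnj (I j) * H k) / of_real p"
      using l2_mult_integrable(2)[OF h indicator_nbhd_l2] by (simp add: H_def l2_inner_def)
    finally show ?thesis .
  qed
  also have "cmod \<dots> = cmod (cnj (I k) * H j - cnj (I j) * H k) / p"
    using nbhd_pos[OF z, of j] by (simp add: norm_divide p_def)
  also have "\<dots> \<le> (cmod (I k) * cmod (H j) + cmod (I j) * cmod (H k)) / p"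
    using norm_triangle_ineq4[of "cnj (I k) * H j" "cnj (I j) * H k"]
    by (intro divide_right_mono) (simp_all add: norm_mult p_def)
  also have "\<dots> \<le> ((ind_norm k * mass \<phi> k) * (ind_norm j * mass h j) + (ind_norm j * mass \<phi> j) * (ind_norm k * mass h k)) / p"
    unfolding I_def H_def using ind_norm_pos mass_nonneg
    by (intro divide_right_mono add_mono mult_mono l2_inner_nbhd_le mult_nonneg_nonneg)
      (auto simp: p_def less_imp_le)
  also have "\<dots> = ind_norm k / ind_norm j * (mass h j * mass \<phi> k + mass \<phi> j * mass h k)"
    using ind_norm_pos[of j] unfolding p_def ind_norm_square[symmetric] by (simp add: field_simps)
  also have "\<dots> \<le> \<kappa> * q ^ (k - j) * (mass h j * mass \<phi> k + mass \<phi> j * mass h k)"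
    by (intro mult_right_mono ind_norm_ratio jk add_nonneg_nonneg mult_nonneg_nonneg mass_nonneg)
  finally show ?thesis using jk by (simp add: I_def p_def)
qed

text \<open>The bound is independent of the height \<open>K\<close> of the tower and of the cut-off \<open>N\<close>: Schur's test
  reduces the double sum over \<open>j < k\<close> to sums of squares, and Bessel's inequality bounds these.\<close>

lemma l2_inner_tower_commutator_le:
  assumes h: "h \<in> l2 M" and \<phi>: "\<phi> \<in> l2 M"
  shows "cmod (\<Sum>j<N. l2_inner M h
      (\<lambda>x. average j (\<lambda>y. tower z K y * \<phi> y) x - tower z K x * average j \<phi> x))
    \<le> tower_const\<^sup>2 * ((l2_norm M h)\<^sup>2 + (l2_norm M \<phi>)\<^sup>2)"
proof -
  define L where "L = N + K"
  define A where "A = mass h"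
  define B where "B = mass \<phi>"
  define d where "d j k = q ^ ((j - k) + (k - j))" for j k :: nat
  define T where "T j k = \<kappa> * d j k * (A j * B k + B j * A k)" for j k
  have T0: "0 \<le> T j k" for j k
    unfolding T_def A_def B_def d_def using kappa_ge_1 q
    by (intro mult_nonneg_nonneg add_nonneg_nonneg mass_nonneg) auto
  have inner: "cmod (l2_inner M h
      (\<lambda>x. average j (\<lambda>y. tower z K y * \<phi> y) x - tower z K x * average j \<phi> x)) \<le> (\<Sum>k\<le>L. T j k)" for j
  proof -
    define c where "c k x = (if j < k
      then (l2_inner M \<phi> (indicator (nbhd G k z)) * indicator (nbhd G j z) x
            - l2_inner M \<phi> (indicator (nbhd G j z)) * indicator (nbhd G k z) x)
          / of_real (prob (nbhd G j z)) else 0)" for k x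
    have c_l2: "c k \<in> l2 M" for k
    proof (cases "j < k")
      case True
      have "(\<lambda>x. inverse (of_real (prob (nbhd G j z)))
          * (l2_inner M \<phi> (indicator (nbhd G k z)) * indicator (nbhd G j z) x
            - l2_inner M \<phi> (indicator (nbhd G j z)) * indicator (nbhd G k z) x)) \<in> l2 M"
        by (intro l2_cmult l2_diff indicator_nbhd_l2)
      with True show ?thesis by (simp add: c_def[abs_def] divide_inverse mult.commute)
    qed (simp add: c_def[abs_def])
    have "l2_inner M h (\<lambda>x. average j (\<lambda>y. tower z K y * \<phi> y) x - tower z K x * average j \<phi> x)
        = l2_inner M h (\<lambda>x. \<Sum>k\<in>{1..K}. c k x)"
      by (simp only: tower_commutator[OF \<phi> z] c_def)
    also have "\<dots> = (\<Sum>k\<in>{1..K}. l2_inner M h (c k))"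
      using l2_mult_integrable(2)[OF h c_l2] by (simp add: l2_inner_def sum_distrib_left)
    also have "cmod \<dots> \<le> (\<Sum>k\<in>{1..K}. T j k)"
    proof (intro sum_norm_le)
      fix k
      show "cmod (l2_inner M h (c k)) \<le> T j k"
      proof (cases "j < k")
        case True
        thus ?thesis using commutator_term_le[OF less_imp_le[OF True] h, of \<phi>]
          by (simp add: c_def[abs_def] T_def d_def A_def B_def)
      next
        case False
        hence "l2_inner M h (c k) = 0" by (simp add: c_def[abs_def] l2_inner_def)
        thus ?thesis using T0 by simp
      qed
    qed
    also have "\<dots> \<le> (\<Sum>k\<le>L. T j k)"
      by (intro sum_mono2 T0) (auto simp: L_def)
    finally show ?thesis .
  qed
  have "cmod (\<Sum>j<N. l2_inner M h
      (\<lambda>x. average j (\<lambda>y. tower z K y * \<phi> y) x - tower z K x * average j \<phi> x)) \<le> (\<Sum>j<N. \<Sum>k\<le>L. T j k)"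
    by (intro sum_norm_le inner)
  also have "\<dots> \<le> (\<Sum>j\<le>L. \<Sum>k\<le>L. T j k)"
    by (intro sum_mono2 sum_nonneg T0) (auto simp: L_def)
  also have "\<dots> = \<kappa> * ((\<Sum>j\<le>L. \<Sum>k\<le>L. d j k * (A j * B k)) + (\<Sum>j\<le>L. \<Sum>k\<le>L. d j k * (B j * A k)))"
    by (simp add: T_def sum_distrib_left sum.distrib distrib_left mult.assoc)
  also have "\<dots> \<le> \<kappa> * (((\<Sum>k\<le>L. (A k)\<^sup>2) + (\<Sum>k\<le>L. (B k)\<^sup>2)) / (1 - q)
      + ((\<Sum>k\<le>L. (B k)\<^sup>2) + (\<Sum>k\<le>L. (A k)\<^sup>2)) / (1 - q))"
    unfolding d_def using kappa_ge_1
    by (intro mult_left_mono add_mono power_distance_form_le q) auto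
  also have "\<dots> = tower_const * ((\<Sum>k\<le>L. (A k)\<^sup>2) + (\<Sum>k\<le>L. (B k)\<^sup>2))"
    by (simp add: tower_const_def add_divide_distrib[symmetric] algebra_simps)
  also have "\<dots> \<le> tower_const * (tower_const * (l2_norm M h)\<^sup>2 + tower_const * (l2_norm M \<phi>)\<^sup>2)"
    unfolding A_def B_def using tower_const_pos
    by (intro mult_left_mono add_mono bessel_tower h \<phi>) auto
  finally show ?thesis by (simp add: power2_eq_square algebra_simps)
qed

text \<open>The commutator applied to \<open>h\<close> is a limit of locally constant functions, so it suffices to test
  it against these; there \<open>D\<close> can be moved to the other side by \<open>dirac_inner\<close>. The scaling factor
  turns the bound \<open>C\<^sup>2 (\<parallel>h\<parallel>\<^sup>2 + \<parallel>\<phi>\<parallel>\<^sup>2)\<close> into half the sum of the squares.\<close>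

lemma commutator_norm_tower:
  "commutator_norm G M (\<lambda>x. of_real (1 / (2 * tower_const\<^sup>2)) * tower z K x) \<le> 1"
proof -
  define s where "s = 1 / (2 * tower_const\<^sup>2)"
  define f where "f x = complex_of_real s * tower z K x" for x
  have s0: "0 < s" using tower_const_pos by (simp add: s_def)
  have f_level: "f \<in> level G (int N)" if "K \<le> N" for N
    unfolding f_def[abs_def] by (rule level_cmult[OF finite_arcs tower_level[OF that]])
  have f_bounded: "cmod (f x) \<le> s * K" for x
    using s0 tower_bounded[of z K x] by (simp add: f_def norm_mult)
  have f_meas: "f \<in> borel_measurable M"
    using level_l2[OF f_level[OF order_refl]] by (simp add: l2_def)
  have cnj_f: "cnj (f x) = f x" for x
    by (simp add: f_def tower_def indicator_def if_distrib)
  have f_l2: "(\<lambda>x. f x * u x) \<in> l2 M" if "u \<in> l2 M" for u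
    by (rule l2_bounded_mult(1)[OF that f_meas f_bounded])
  have f_adjoint: "l2_inner M (\<lambda>x. f x * u x) v = l2_inner M u (\<lambda>x. f x * v x)" for u v
    unfolding l2_inner_def by (intro Bochner_Integration.integral_cong refl) (simp add: cnj_f mult_ac)
  have average_f: "average j (\<lambda>y. f y * v y) x = s * average j (\<lambda>y. tower z K y * v y) x" for j v x
    by (simp add: average_def f_def mult.assoc l2_inner_cmult_left)
  have "l2_norm M (\<lambda>x. k x - f x * g x) \<le> 1"
    if D: "dirac G M h g" and Df: "dirac G M (\<lambda>x. f x * h x) k" and norm: "l2_norm M h \<le> 1" for h g k
  proof -
    from D obtain c where h: "h \<in> l2 M" and g: "g \<in> l2 M" and c: "\<And>n. c n \<in> level_perp G M n"
      and sum_g: "l2_sums M (\<lambda>n x. of_nat n * c n x) g"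
      by (auto simp: dirac_def)
    from Df obtain c' where k: "k \<in> l2 M" and c': "\<And>n. c' n \<in> level_perp G M n"
      and sum_k: "l2_sums M (\<lambda>n x. of_nat n * c' n x) k"
      by (auto simp: dirac_def)
    \<comment> \<open>Partial sums of \<open>g = D h\<close> and \<open>k = D (f h)\<close>, and the resulting approximants of \<open>k - f g\<close>.\<close>
    define P where "P N x = (\<Sum>n<N. of_nat n * c n x)" for N x
    define P' where "P' N x = (\<Sum>n<N. of_nat n * c' n x)" for N x
    define F where "F N x = P' N x - f x * P N x" for N x
    have c_level: "c n \<in> level G (int N)" "c' n \<in> level G (int N)" if "n < N" for n N
      using level_mono[OF finite_arcs _ less_imp_le[OF that]] c[of n] c'[of n]
      by (simp_all add: level_perp_def)
    have P_level: "P N \<in> level G (int N)" "P' N \<in> level G (int N)" for N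
      unfolding P_def[abs_def] P'_def[abs_def]
      by (intro level_sum[OF finite_arcs] level_cmult[OF finite_arcs] c_level; simp)+
    note P_l2 = P_level[THEN level_l2]
    have F_l2: "F N \<in> l2 M" for N
      unfolding F_def[abs_def] by (intro l2_diff f_l2 P_l2)
    have z_l2: "(\<lambda>x. k x - f x * g x) \<in> l2 M" by (intro l2_diff f_l2 k g)
    show ?thesis
    proof (rule l2_norm_le_1_by_testing[OF F_l2 z_l2])
      show "(\<lambda>N. l2_norm M (\<lambda>x. (k x - f x * g x) - F N x)) \<longlonglongrightarrow> 0"
      proof (rule Lim_null_comparison)
        have "l2_norm M (\<lambda>x. (k x - f x * g x) - F N x)
            \<le> l2_norm M (\<lambda>x. k x - P' N x) + s * K * l2_norm M (\<lambda>x. P N x - g x)" for N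
        proof -
          have "l2_norm M (\<lambda>x. (k x - f x * g x) - F N x)
              = l2_norm M (\<lambda>x. (k x - P' N x) + f x * (P N x - g x))"
            by (simp add: F_def algebra_simps)
          also have "\<dots> \<le> l2_norm M (\<lambda>x. k x - P' N x) + l2_norm M (\<lambda>x. f x * (P N x - g x))"
            by (intro l2_norm_triangle f_l2 l2_diff k g P_l2)
          also have "l2_norm M (\<lambda>x. f x * (P N x - g x)) \<le> s * K * l2_norm M (\<lambda>x. P N x - g x)"
            by (intro l2_bounded_mult(2) l2_diff g P_l2 f_meas f_bounded)
          finally show ?thesis by simp
        qed
        thus "\<forall>\<^sub>F N in sequentially. norm (l2_norm M (\<lambda>x. (k x - f x * g x) - F N x))
            \<le> l2_norm M (\<lambda>x. k x - P' N x) + s * K * l2_norm M (\<lambda>x. P N x - g x)"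
          by (intro always_eventually allI) simp
        have "(\<lambda>N. l2_norm M (\<lambda>x. k x - P' N x) + s * K * l2_norm M (\<lambda>x. P N x - g x))
            \<longlonglongrightarrow> 0 + s * K * 0"
          using sum_g sum_k
          by (intro tendsto_intros)
            (simp_all add: l2_sums_def P_def P'_def l2_norm_minus_commute[of M _ g])
        thus "(\<lambda>N. l2_norm M (\<lambda>x. k x - P' N x) + s * K * l2_norm M (\<lambda>x. P N x - g x)) \<longlonglongrightarrow> 0"
          by simp
      qed
    next
      fix N assume KN: "K \<le> N"
      define \<phi> where "\<phi> = F N"
      have \<phi>: "\<phi> \<in> level G (int N)"
        unfolding \<phi>_def F_def[abs_def]
        by (intro level_diff[OF finite_arcs] level_mult[OF finite_arcs] P_level f_level KN)
      have f\<phi>: "(\<lambda>x. f x * \<phi> x) \<in> level G (int N)"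
        by (rule level_mult[OF finite_arcs f_level[OF KN] \<phi>])
      note av_l2 = level_l2[OF average_level]
      have \<phi>_l2: "\<phi> \<in> l2 M" by (rule level_l2[OF \<phi>])
      have "l2_inner M (\<lambda>x. k x - f x * g x) \<phi> = l2_inner M k \<phi> - l2_inner M g (\<lambda>x. f x * \<phi> x)"
        by (simp add: l2_inner_diff_left[OF k f_l2[OF g] \<phi>_l2] f_adjoint)
      also have "\<dots> = (\<Sum>j<N. l2_inner M h (average j (\<lambda>x. f x * \<phi> x)) - l2_inner M h (\<lambda>x. f x * average j \<phi> x))"
        unfolding dirac_inner[OF Df \<phi>] dirac_inner[OF D f\<phi>] f_adjoint sum_subtractf[symmetric]
        by (intro sum.cong refl) simp
      also have "\<dots> = (\<Sum>j<N. s * l2_inner M h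
          (\<lambda>x. average j (\<lambda>y. tower z K y * \<phi> y) x - tower z K x * average j \<phi> x))"
      proof (intro sum.cong refl)
        fix j
        have "l2_inner M h (average j (\<lambda>x. f x * \<phi> x)) - l2_inner M h (\<lambda>x. f x * average j \<phi> x)
            = l2_inner M h (\<lambda>x. average j (\<lambda>x. f x * \<phi> x) x - f x * average j \<phi> x)"
          by (intro l2_inner_diff_right[symmetric] av_l2 f_l2 h)
        also have "\<dots> = l2_inner M h (\<lambda>x. s *
            (average j (\<lambda>y. tower z K y * \<phi> y) x - tower z K x * average j \<phi> x))"
          unfolding average_f by (simp only: f_def right_diff_distrib mult.assoc)
        also have "\<dots> = s * l2_inner M h
            (\<lambda>x. average j (\<lambda>y. tower z K y * \<phi> y) x - tower z K x * average j \<phi> x)"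
          by (simp add: l2_inner_def mult.left_commute)
        finally show "l2_inner M h (average j (\<lambda>x. f x * \<phi> x)) - l2_inner M h (\<lambda>x. f x * average j \<phi> x) = \<dots>" .
      qed
      finally have eq: "l2_inner M (\<lambda>x. k x - f x * g x) \<phi> = s * (\<Sum>j<N. l2_inner M h
          (\<lambda>x. average j (\<lambda>y. tower z K y * \<phi> y) x - tower z K x * average j \<phi> x))"
        by (simp only: sum_distrib_left)
      have "cmod (l2_inner M (\<lambda>x. k x - f x * g x) \<phi>)
          \<le> s * (tower_const\<^sup>2 * ((l2_norm M h)\<^sup>2 + (l2_norm M \<phi>)\<^sup>2))"
        unfolding eq norm_mult using s0 l2_inner_tower_commutator_le[OF h \<phi>_l2, of K N] by simp
      also have "\<dots> = ((l2_norm M h)\<^sup>2 + (l2_norm M \<phi>)\<^sup>2) / 2"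
        using tower_const_pos by (simp add: s_def)
      also have "\<dots> \<le> (1 + (l2_norm M \<phi>)\<^sup>2) / 2"
        using norm by (simp add: power_le_one)
      finally show "cmod (l2_inner M (\<lambda>x. k x - f x * g x) (F N)) \<le> (1 + (l2_norm M (F N))\<^sup>2) / 2"
        by (simp add: \<phi>_def)
    qed
  qed
  hence "commutator_norm G M f \<le> 1"
    unfolding commutator_norm_def by (intro SUP_least) (auto simp: ennreal_le_1)
  thus ?thesis by (simp add: f_def[abs_def] s_def)
qed

text \<open>The towers grow without bound at \<open>z\<close>, while at \<open>y\<close> only the cylinders below the level that
  separates \<open>y\<close> from \<open>z\<close> contribute.\<close>

theorem connes_infinite_of_other_point:
  assumes y: "y \<in> sft G" "y \<noteq> z"
  shows "connes_infinite G M"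
proof -
  define s where "s = 1 / (2 * tower_const\<^sup>2)"
  have s0: "0 < s" using tower_const_pos by (simp add: s_def)
  obtain J where J: "\<And>n. n \<ge> J \<Longrightarrow> y \<notin> nbhd G n z" using nbhd_separates[of z y G] y by auto
  define dist where "dist = connes_metric G M (\<lambda>f. f z) (\<lambda>f. f y)"
  have ge: "ennreal (s * real K - s * real J) \<le> dist" for K
  proof -
    define f where "f x = complex_of_real s * tower z K x" for x
    have f: "f \<in> c_infty G"
      unfolding c_infty_def f_def[abs_def]
      using level_cmult[OF finite_arcs tower_level[OF order_refl, where K = K]] by blast
    have fz: "f z = s * K" using z by (simp add: f_def tower_def)
    have "tower z K y = (\<Sum>k\<in>{1..K} \<inter> {..J}. indicator (nbhd G k z) y)"
      unfolding tower_def using J by (intro sum.mono_neutral_right) (auto simp: indicator_def)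
    also have "cmod \<dots> \<le> (\<Sum>k\<in>{1..K} \<inter> {..J}. 1)"
      by (intro sum_norm_le) (auto simp: indicator_def)
    also have "\<dots> \<le> real J"
      using card_mono[of "{1..J}" "{1..K} \<inter> {..J}"] by auto
    finally have fy: "cmod (f y) \<le> s * J" using s0 by (simp add: f_def norm_mult)
    have "s * real K - s * real J \<le> cmod (f z - f y)"
      using norm_triangle_ineq2[of "f z" "f y"] fy s0 by (simp add: fz norm_mult)
    moreover have "f \<in> {f \<in> c_infty G. commutator_norm G M f \<le> 1}"
      using f commutator_norm_tower[of K] by (simp add: f_def[abs_def] s_def)
    ultimately show ?thesis
      unfolding dist_def connes_metric_def by (intro SUP_upper2[of f]) (auto intro: ennreal_leI)
  qed
  have "dist = \<infinity>"
  proof (rule ccontr)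
    assume "dist \<noteq> \<infinity>"
    then obtain r where r: "0 \<le> r" "dist = ennreal r" by (cases dist) auto
    obtain K :: nat where "real K > real J + r / s" using reals_Archimedean2 by blast
    hence "s * real K - s * real J > r" using s0 by (simp add: field_simps)
    with ge[of K] r show False by (simp add: ennreal_le_iff)
  qed
  thus ?thesis
    using point_evaluation_is_state[OF z] point_evaluation_is_state[OF y(1)]
    unfolding connes_finite_def dist_def by (metis infinity_ennreal_def less_irrefl)
qed

end

section \<open>Cylinder measures of the Parry measure\<close>

lemma invariant_prob_translate:
  assumes inv: "invariant_prob G M" and W: "finite W"
  shows "measure M {y \<in> sft G. \<forall>i\<in>W. y (i + p) = w i} = measure M {y \<in> sft G. \<forall>i\<in>W. y i = w i}"
proof -
  define C where "C p = {y \<in> sft G. \<forall>i\<in>W. y (i + p) = w i}" for p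
  have sets: "sets M = sets (sft_borel G)" using inv by (simp add: invariant_prob_def)
  hence space: "space M = sft G" using sets_eq_imp_space_eq[OF sets] by (simp add: space_sft_borel)
  have step: "measure M (C (p + 1)) = measure M (C p)" for p
  proof -
    have "C p = {y \<in> sft G. \<forall>j\<in>(\<lambda>i. i + p) ` W. y j = w (j - p)}" by (auto simp: C_def)
    hence "C p \<in> sets M" unfolding sets using W by (simp only: cylinder_borel finite_imageI)
    hence "emeasure M (shift -` C p \<inter> space M) = emeasure M (C p)"
      using inv by (simp add: invariant_prob_def)
    moreover have "shift -` C p \<inter> space M = C (p + 1)"
      using sft_translate[of _ G 1] by (auto simp: C_def space shift_def add.assoc)
    ultimately show ?thesis by (simp add: measure_def)
  qed
  have "measure M (C p) = measure M (C 0)"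
  proof (induction p rule: int_induct[of _ 0])
    case (step2 i)
    thus ?case using step[of "i - 1"] by simp
  qed (simp_all add: step)
  thus ?thesis by (simp add: C_def)
qed

text \<open>The defining formula concerns words read at the coordinates from 1 to \<open>n\<close>; by invariance it
  holds for the centred windows as well.\<close>

lemma parry_measure_nbhd:
  assumes "parry_measure G M"
  obtains lam u v where "perron_data G lam u v"
    and "\<And>n x. n \<ge> 1 \<Longrightarrow> x \<in> sft G \<Longrightarrow> \<exists>e\<in>arcs G. \<exists>f\<in>arcs G.
      measure M (nbhd G n x) = u $ tail G e * v $ head G f / lam ^ n"
proof -
  from assms obtain lam u v where inv: "invariant_prob G M" and perron: "perron_data G lam u v"
    and words: "\<And>n w. n \<ge> 1 \<Longrightarrow> w \<in> words G n \<Longrightarrow> measure M {x \<in> sft G. map x [1..int n] = w} =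
             u $ tail G (hd w) * v $ head G (last w) / lam ^ n"
    by (auto simp: parry_measure_def)
  have "\<exists>e\<in>arcs G. \<exists>f\<in>arcs G. measure M (nbhd G n x) = u $ tail G e * v $ head G f / lam ^ n"
    if n: "n \<ge> 1" and x: "x \<in> sft G" for n x
  proof -
    define d where "d = int ((n + 1) div 2)"
    define w where "w = map (\<lambda>i. x (i - d)) [1..int n]"
    have w: "w \<in> words G n" unfolding words_def w_def using sft_translate[OF x, of "- d"] by auto
    have ne: "w \<noteq> []" using n by (simp add: w_def)
    have arcs: "hd w \<in> arcs G" "last w \<in> arcs G"
      using hd_in_set[OF ne] last_in_set[OF ne] x by (auto simp: w_def sft_def)
    have "nbhd G n x = {y \<in> sft G. \<forall>i\<in>{1..int n}. y (i - d) = x (i - d)}"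
      unfolding nbhd_def window_shift d_def set_map set_upto by blast
    hence "measure M (nbhd G n x) = measure M {y \<in> sft G. \<forall>i\<in>{1..int n}. y i = x (i - d)}"
      using invariant_prob_translate[OF inv finite_atLeastAtMost_int, of 1 "int n" "- d" "\<lambda>i. x (i - d)"]
      by simp
    also have "{y \<in> sft G. \<forall>i\<in>{1..int n}. y i = x (i - d)} = {y \<in> sft G. map y [1..int n] = w}"
      by (simp add: w_def)
    finally show ?thesis using words[OF n w] arcs by auto
  qed
  with perron show ?thesis using that by blast
qed

text \<open>The eigenvector factors take finitely many values, all of them positive. The sign of the
  eigenvalue follows from the formula itself: some cylinder of level 1 has positive measure.\<close>

lemma parry_measure_nbhd_bounds:
  assumes fin: "fin_digraph G" and parry: "parry_measure G M"
  obtains a lam b :: real where "0 < a" "0 < lam"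
    "\<forall>n. \<forall>x\<in>sft G. a / lam ^ n \<le> measure M (nbhd G n x)"
    "\<forall>n. \<forall>x\<in>sft G. measure M (nbhd G n x) \<le> b / lam ^ n"
proof -
  interpret G: fin_digraph G by (rule fin)
  from parry have inv: "invariant_prob G M" by (simp add: parry_measure_def)
  then interpret prob_space M by (simp add: invariant_prob_def)
  have sets: "sets M = sets (sft_borel G)" using inv by (simp add: invariant_prob_def)
  hence space: "space M = sft G" using sets_eq_imp_space_eq[OF sets] by (simp add: space_sft_borel)
  from parry_measure_nbhd[OF parry] obtain lam u v where perron: "perron_data G lam u v"
    and nbhd: "\<And>n x. n \<ge> 1 \<Longrightarrow> x \<in> sft G \<Longrightarrow> \<exists>e\<in>arcs G. \<exists>f\<in>arcs G.
      prob (nbhd G n x) = u $ tail G e * v $ head G f / lam ^ n"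
    by blast
  \<comment> \<open>The value 1 accounts for level 0, where the cylinder is the whole space.\<close>
  define S where "S = insert 1 ((\<lambda>(e, f). u $ tail G e * v $ head G f) ` (arcs G \<times> arcs G))"
  define a where "a = Min S"
  define b where "b = Max S"
  have S: "finite S" "S \<noteq> {}" by (simp_all add: S_def)
  have S_pos: "0 < s" if "s \<in> S" for s
    using that perron by (auto simp: S_def perron_data_def intro!: mult_pos_pos)
  have a: "0 < a" using S_pos Min_in[OF S] by (simp add: a_def)
  have "lam > 0"
  proof (rule ccontr)
    assume neg: "\<not> lam > 0"
    have null: "prob (cyl G w) = 0" if "w \<in> words G 1" for w
    proof -
      from that obtain x where x: "x \<in> sft G" "w = map x (window 1)" by (auto simp: words_eq)
      from nbhd[OF order_refl x(1)] obtain s where "s \<in> S" "prob (nbhd G 1 x) = s / lam"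
        by (auto simp: S_def)
      hence "prob (nbhd G 1 x) \<le> 0" using S_pos[of s] neg by (simp add: divide_nonneg_nonpos)
      hence "prob (nbhd G 1 x) = 0" by (rule antisym[OF _ measure_nonneg])
      thus ?thesis unfolding x(2) cyl_eq_nbhd .
    qed
    have "sft G = (\<Union>w\<in>words G 1. cyl G w)"
      by (auto simp: cyl_def words_eq)
    moreover have "cyl G ` words G 1 \<subseteq> events"
      by (auto simp: sets words_eq cyl_eq_nbhd nbhd_borel)
    ultimately have "prob (sft G) \<le> (\<Sum>w\<in>words G 1. prob (cyl G w))"
      using finite_measure_subadditive_finite[of "words G 1" "cyl G"] finite_words[of G 1] by simp
    hence "prob (sft G) \<le> 0" using null by simp
    thus False using prob_space by (simp add: space)
  qed
  moreover have "\<exists>s\<in>S. prob (nbhd G n x) = s / lam ^ n" if x: "x \<in> sft G" for n x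
  proof (cases "n = 0")
    case True
    have "nbhd G n x = space M" by (auto simp: True nbhd_def window_def space)
    thus ?thesis using prob_space by (simp add: S_def True)
  next
    case False
    thus ?thesis using nbhd[OF _ x, of n] by (force simp: S_def)
  qed
  hence "a / lam ^ n \<le> prob (nbhd G n x) \<and> prob (nbhd G n x) \<le> b / lam ^ n"
    if "x \<in> sft G" for n x
    using that \<open>lam > 0\<close> Min_le[OF S(1)] Max_ge[OF S(1)]
    by (metis a_def b_def divide_right_mono less_imp_le zero_less_power)
  ultimately show ?thesis by (intro that[of a lam b] a) auto
qed

text \<open>Otherwise every cylinder has measure at least \<open>a\<close>, but an infinite space contains more than
  \<open>1 / a\<close> points, which lie in disjoint cylinders of a sufficiently high level.\<close>

lemma (in sft_prob) cylinder_rate_gt_1: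
  assumes inf: "infinite (sft G)" and a: "0 < a" and lam: "0 < lam"
    and lower: "\<And>n x. x \<in> sft G \<Longrightarrow> a / lam ^ n \<le> prob (nbhd G n x)"
  shows "1 < lam"
proof (rule ccontr)
  assume le: "\<not> 1 < lam"
  obtain B :: nat where B: "real B * a > 1" using a reals_Archimedean3[of a] by blast
  obtain S where S: "finite S" "card S = B" "S \<subseteq> sft G"
    using infinite_arbitrarily_large[OF inf] by blast
  obtain n where n: "\<And>x y. x \<in> S \<Longrightarrow> y \<in> S \<Longrightarrow> x \<noteq> y \<Longrightarrow> y \<notin> nbhd G n x"
    using nbhd_separates_finite[OF S(1), of G] by blast
  have disj: "disjoint_family_on (nbhd G n) S"
    unfolding disjoint_family_on_def
  proof (intro ballI impI)
    fix x y assume xy: "x \<in> S" "y \<in> S" "x \<noteq> y"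
    hence "x \<notin> nbhd G n y" using n by blast
    thus "nbhd G n x \<inter> nbhd G n y = {}" using xy S(3) by (intro nbhd_disjointI) auto
  qed
  have "a \<le> a / lam ^ n" using a lam le by (simp add: le_divide_eq mult_left_le power_le_one)
  hence "(\<Sum>x\<in>S. a) \<le> (\<Sum>x\<in>S. prob (nbhd G n x))"
    using lower[of _ n] S(3) by (intro sum_mono) force
  also have "\<dots> = prob (\<Union>x\<in>S. nbhd G n x)"
    by (rule finite_measure_finite_Union[OF S(1) _ disj, symmetric]) auto
  also have "\<dots> \<le> 1" by (rule prob_le_1)
  finally show False using B S(2) by simp
qed

text \<open>The ratio of two nested cylinder measures is at most \<open>b / a\<close> times the expected power of
  \<open>1 / lam\<close>, so every point carries a tower of geometrically shrinking cylinders.\<close>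

lemma (in sft_prob) connes_infinite_of_uniform_cylinders:
  assumes inf: "infinite (sft G)" and a: "0 < a" and lam: "0 < lam"
    and lower: "\<And>n x. x \<in> sft G \<Longrightarrow> a / lam ^ n \<le> prob (nbhd G n x)"
    and upper: "\<And>n x. x \<in> sft G \<Longrightarrow> prob (nbhd G n x) \<le> b / lam ^ n"
  shows "connes_infinite G M"
proof -
  have lam1: "1 < lam" by (rule cylinder_rate_gt_1[OF inf a lam lower])
  have "sft G \<noteq> {}" using inf by auto
  then obtain z where z: "z \<in> sft G" by blast
  have "sft G - {z} \<noteq> {}" using inf by (metis finite.emptyI infinite_remove)
  then obtain y where y: "y \<in> sft G" "y \<noteq> z" by blast
  have b: "0 < b"
    using lower[OF z, of 0] upper[OF z, of 0] a by simp
  define q where "q = 1 / sqrt lam"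
  have q: "0 \<le> q" "q < 1" using lam1 by (simp_all add: q_def)
  have "sqrt (prob (nbhd G j z)) \<le> sqrt (b / a) * q ^ (j - i) * sqrt (prob (nbhd G i z))"
    if ij: "i \<le> j" for i j
  proof -
    have "prob (nbhd G j z) \<le> b / lam ^ j" by (rule upper[OF z])
    also have "\<dots> = b / a * (1 / lam) ^ (j - i) * (a / lam ^ i)"
      using a lam power_add[of lam i "j - i"] ij by (simp add: power_one_over field_simps)
    also have "\<dots> \<le> b / a * (1 / lam) ^ (j - i) * prob (nbhd G i z)"
      using a b lam by (intro mult_left_mono lower z) auto
    finally have "sqrt (prob (nbhd G j z)) \<le> sqrt (b / a * (1 / lam) ^ (j - i) * prob (nbhd G i z))"
      by simp
    thus ?thesis by (simp only: real_sqrt_mult real_sqrt_power real_sqrt_divide real_sqrt_one q_def)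
  qed
  then interpret decaying_tower M G z "sqrt (b / a)" q
    by unfold_locales (use z q in auto)
  show ?thesis by (rule connes_infinite_of_other_point[OF y])
qed

theorem theorem5p8:
  fixes G :: "(nat, 'e) pre_digraph" and I :: nat and \<mu> :: "(int \<Rightarrow> 'e) measure"
  assumes "fin_digraph G"
    and "verts G = {0..<I}"
    and "aperiodic_graph G"
    and "irreducible_graph G"
    and "parry_measure G \<mu>"
  shows "connes_infinite G \<mu>"
proof -
  obtain a lam b :: real where a: "0 < a" and lam: "0 < lam"
    and lower: "\<forall>n. \<forall>x\<in>sft G. a / lam ^ n \<le> measure \<mu> (nbhd G n x)"
    and upper: "\<forall>n. \<forall>x\<in>sft G. measure \<mu> (nbhd G n x) \<le> b / lam ^ n"
    by (rule parry_measure_nbhd_bounds[OF assms(1,5)])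
  have pos: "0 < measure \<mu> (nbhd G n x)" if "x \<in> sft G" for n x
    by (rule less_le_trans[OF _ lower[rule_format, OF that]]) (simp add: a lam)
  have "invariant_prob G \<mu>" using assms(5) by (simp add: parry_measure_def)
  then interpret prob_space \<mu> by (simp add: invariant_prob_def)
  interpret sft_prob \<mu> G
  proof
    show "finite (arcs G)" by (rule fin_digraph.finite_arcs[OF assms(1)])
    show "sets \<mu> = sets (sft_borel G)"
      using \<open>invariant_prob G \<mu>\<close> by (simp add: invariant_prob_def)
  qed (rule pos)
  have "infinite (sft G)" using assms(3) by (simp add: aperiodic_graph_def)
  thus ?thesis
    by (rule connes_infinite_of_uniform_cylinders[OF _ a lam lower[rule_format] upper[rule_format]])
qed

end
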